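(* Let $s\ge 1$, and suppose that width $s$ weak moonshine holds for a finite group $G$, with graded module $V_G$, irreducible characters $\chi_1,\dots,\chi_t$ and McKay-Thompson series $\{T(r,\underline{g};\tau): 1\le r\le s,\ \underline{g}\in G^{(r)}\}$. If $1\le r\le s$ and $\dim\chi_i\ge r$, then the multiplicity generating function for $\rho_i$ in $V_G$ satisfies $$\mathcal{M}_i(\tau):=\sum_{n\gg-\infty}m_i(n)q^n=\frac{(\dim\chi_i)^{r-1}}{r!\,|G|^r(\dim\chi_i-1)\cdots(\dim\chi_i-(r-1))}\sum_{\underline{g}\in G^{(r)}}\overline{\chi_i^{(r)}(\underline{g})}\,T(r,\underline{g};\tau),$$ where the product $(\dim\chi_i-1)\cdots(\dim\chi_i-(r-1))$ is empty and equal to $1$ when $r=1$.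
   Context: Notation: $\tau$ lies in the complex upper half-plane $\mathbb{H}$ and $q=e^{2\pi i\tau}$. A weakly holomorphic modular function is a holomorphic function on $\mathbb{H}$ that is invariant (weight $0$) under a congruence subgroup of $\mathrm{SL}_2(\mathbb{Z})$ and is meromorphic at all cusps (poles at cusps are allowed). Let $\rho_1,\dots,\rho_t$ be the irreducible complex representations of the finite group $G$ (one per isomorphism class), with characters $\chi_1,\dots,\chi_t$; write $\dim\chi_i=\chi_i(1)$. For $r\in\mathbb{Z}^{+}$ let $G^{(r)}=G\times\cdots\times G$ ($r$ copies). Frobenius $r$-characters: for an irreducible character $\chi$ of $G$, put $\chi^{(1)}(g)=\chi(g)$, $\chi^{(2)}(g_1,g_2)=\chi(g_1)\chi(g_2)-\chi(g_1g_2)$, and for $r\ge 3$ define $\chi^{(r)}:G^{(r)}\to\mathbb{C}$ recursively by $$\chi^{(r)}(g_1,\dots,g_r)=\chi(g_1)\chi^{(r-1)}(g_2,\dots,g_r)-\chi^{(r-1)}(g_1g_2,g_3,\dots,g_r)-\chi^{(r-1)}(g_2,g_1g_3,\dots,g_r)-\cdots-\chi^{(r-1)}(g_2,\dots,g_1g_r).$$ Let $V_G=\bigoplus_{n\in\{-d\}\cup\mathbb{Z}^{+}}V_G(n)$, for some integer $d>0$, be an infinite-dimensional graded complex $G$-module with each $V_G(n)$ a finite-dimensional representation of $G$, and let $m_i(n)$ be the multiplicity of $\rho_i$ in $V_G(n)$. For $r\ge1$ and $\underline{g}\in G^{(r)}$ define $\mathrm{Frob}_r(\underline{g};n)=\sum_{1\le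 i\le t}m_i(n)\chi_i^{(r)}(\underline{g})$ and the width $r$ McKay-Thompson series $T(r,\underline{g};\tau)=\sum_{n\gg-\infty}\mathrm{Frob}_r(\underline{g};n)q^n$. Width $s$ weak moonshine holds for $G$ (with module $V_G$) if for each $1\le r\le s$ and each $\underline{g}\in G^{(r)}$, $T(r,\underline{g};\tau)$ is a weakly holomorphic modular function. *)

theory Defs
  imports "HOL-Complex_Analysis.Complex_Analysis" "Jordan_Normal_Form.VS_Connect"
begin

text \<open>Finite-dimensional complex representations of a group are matrix representations. Only the
  values on the carrier of the group matter.\<close>

definition matrix_rep :: "('g, 'm) monoid_scheme \<Rightarrow> nat \<Rightarrow> ('g \<Rightarrow> complex mat) \<Rightarrow> bool" where
  "matrix_rep G n R \<longleftrightarrow>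
     (\<forall>g\<in>carrier G. R g \<in> carrier_mat n n) \<and>
     R \<one>\<^bsub>G\<^esub> = 1\<^sub>m n \<and>
     (\<forall>g\<in>carrier G. \<forall>h\<in>carrier G. R (g \<otimes>\<^bsub>G\<^esub> h) = R g * R h)"

definition rep_dim :: "('g, 'm) monoid_scheme \<Rightarrow> ('g \<Rightarrow> complex mat) \<Rightarrow> nat" where
  "rep_dim G R = dim_row (R \<one>\<^bsub>G\<^esub>)"

definition irreducible_rep :: "('g, 'm) monoid_scheme \<Rightarrow> nat \<Rightarrow> ('g \<Rightarrow> complex mat) \<Rightarrow> bool" where
  "irreducible_rep G n R \<longleftrightarrow>
     matrix_rep G n R \<and> n > 0 \<and>
     (\<forall>W. VectorSpace.subspace class_ring W (module_vec TYPE(complex) n) \<longrightarrow>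
          (\<forall>g\<in>carrier G. \<forall>w\<in>W. R g *\<^sub>v w \<in> W) \<longrightarrow>
          W = {0\<^sub>v n} \<or> W = carrier_vec n)"

definition equivalent_reps ::
    "('g, 'm) monoid_scheme \<Rightarrow> ('g \<Rightarrow> complex mat) \<Rightarrow> ('g \<Rightarrow> complex mat) \<Rightarrow> bool" where
  "equivalent_reps G R S \<longleftrightarrow> (\<exists>P Q. \<forall>g\<in>carrier G. similar_mat_wit (R g) (S g) P Q)"

definition complete_irreps :: "('g, 'm) monoid_scheme \<Rightarrow> nat \<Rightarrow> (nat \<Rightarrow> 'g \<Rightarrow> complex mat) \<Rightarrow> bool" where
  "complete_irreps G t \<rho> \<longleftrightarrow>
     (\<forall>i\<in>{1..t}. irreducible_rep G (rep_dim G (\<rho> i)) (\<rho> i)) \<and>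
     (\<forall>i\<in>{1..t}. \<forall>j\<in>{1..t}. equivalent_reps G (\<rho> i) (\<rho> j) \<longrightarrow> i = j) \<and>
     (\<forall>n R. irreducible_rep G n R \<longrightarrow> (\<exists>i\<in>{1..t}. equivalent_reps G R (\<rho> i)))"

definition character :: "('g \<Rightarrow> complex mat) \<Rightarrow> 'g \<Rightarrow> complex" where
  "character R g = (\<Sum>k<dim_row (R g). R g $$ (k, k))"

lemma character_one:
  assumes "matrix_rep G n R"
  shows "character R \<one>\<^bsub>G\<^esub> = of_nat (rep_dim G R)" "rep_dim G R = n"
  using assms by (auto simp: matrix_rep_def character_def rep_dim_def)

text \<open>The \<open>r\<close>-character is a function of a list of \<open>r\<close> group elements; the value at the empty list
  is a convention that is never used.\<close>

function (sequential) frob_char :: "('g, 'm) monoid_scheme \<Rightarrow> ('g \<Rightarrow> complex) \<Rightarrow> 'g list \<Rightarrow> complex" where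
  "frob_char G chi [] = 1"
| "frob_char G chi [g] = chi g"
| "frob_char G chi [g1, g2] = chi g1 * chi g2 - chi (g1 \<otimes>\<^bsub>G\<^esub> g2)"
| "frob_char G chi (g1 # g2 # g3 # gs) =
     chi g1 * frob_char G chi (g2 # g3 # gs) -
     (\<Sum>j<length (g2 # g3 # gs).
        frob_char G chi ((g2 # g3 # gs)[j := g1 \<otimes>\<^bsub>G\<^esub> (g2 # g3 # gs) ! j]))"
  by pat_completeness auto
termination
  by (relation "Wellfounded.measure (\<lambda>(G, chi, gs). length gs)") (auto split: nat.splits)

definition group_tuples :: "('g, 'm) monoid_scheme \<Rightarrow> nat \<Rightarrow> 'g list set" where
  "group_tuples G r = {gs. length gs = r \<and> set gs \<subseteq> carrier G}"

definition grading_degrees :: "int \<Rightarrow> int set" where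
  "grading_degrees d = insert (- d) {1..}"

text \<open>A complex \<open>G\<close>-module on the whole type \<open>'v\<close> that is the internal direct sum of
  finite-dimensional submodules \<open>V n\<close>, where \<open>n\<close> is \<open>-d\<close> or positive.\<close>

locale graded_G_module = group G + vector_space smul
  for G :: "('g, 'm) monoid_scheme" (structure)
    and smul :: "complex \<Rightarrow> 'v::ab_group_add \<Rightarrow> 'v" +
  fixes act :: "'g \<Rightarrow> 'v \<Rightarrow> 'v"
    and V :: "int \<Rightarrow> 'v set"
    and d :: int
  assumes act_linear: "g \<in> carrier G \<Longrightarrow> Vector_Spaces.linear smul smul (act g)"
    and act_one: "act \<one> v = v"
    and act_mult: "g \<in> carrier G \<Longrightarrow> h \<in> carrier G \<Longrightarrow> act (g \<otimes> h) v = act g (act h v)"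
    and d_pos: "d > 0"
    and component_subspace: "n \<in> grading_degrees d \<Longrightarrow> subspace (V n)"
    and component_stable:
      "n \<in> grading_degrees d \<Longrightarrow> g \<in> carrier G \<Longrightarrow> v \<in> V n \<Longrightarrow> act g v \<in> V n"
    and component_finite_dim: "n \<in> grading_degrees d \<Longrightarrow> \<exists>B. finite B \<and> span B = V n"
    and components_span: "span (\<Union>n\<in>grading_degrees d. V n) = UNIV"
    and components_independent:
      "finite F \<Longrightarrow> F \<subseteq> grading_degrees d \<Longrightarrow> (\<And>n. n \<in> F \<Longrightarrow> x n \<in> V n) \<Longrightarrow>
       (\<Sum>n\<in>F. x n) = 0 \<Longrightarrow> n \<in> F \<Longrightarrow> x n = 0"
    and infinite_dim: "\<not> (\<exists>B. finite B \<and> span B = UNIV)"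

text \<open>The submodule \<open>W\<close> has a basis in which the group acts by the matrices \<open>R g\<close>, that is, \<open>W\<close> is
  isomorphic to the representation \<open>R\<close>.\<close>

definition affords ::
    "('g, 'm) monoid_scheme \<Rightarrow> (complex \<Rightarrow> 'v::ab_group_add \<Rightarrow> 'v) \<Rightarrow> ('g \<Rightarrow> 'v \<Rightarrow> 'v) \<Rightarrow>
     'v set \<Rightarrow> ('g \<Rightarrow> complex mat) \<Rightarrow> bool" where
  "affords G smul act W R \<longleftrightarrow>
     (\<exists>bs. length bs = rep_dim G R \<and> distinct bs \<and>
           \<not> Modules.module.dependent smul (set bs) \<and>
           Modules.module.span smul (set bs) = W \<and>
           (\<forall>g\<in>carrier G. \<forall>j<length bs.
              act g (bs ! j) = (\<Sum>i<length bs. smul (R g $$ (i, j)) (bs ! i))))"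

text \<open>The direct sum of \<open>k j\<close> copies of \<open>\<rho> j\<close>, for \<open>j = 1, \<dots>, t\<close>.\<close>

definition direct_sum_reps :: "nat \<Rightarrow> (nat \<Rightarrow> 'g \<Rightarrow> complex mat) \<Rightarrow> (nat \<Rightarrow> nat) \<Rightarrow> 'g \<Rightarrow> complex mat" where
  "direct_sum_reps t \<rho> k g = diag_block_mat (concat (map (\<lambda>j. replicate (k j) (\<rho> j g)) [1..<Suc t]))"

text \<open>The number of copies of \<open>\<rho> i\<close> in a decomposition of \<open>W\<close> into irreducibles; for a
  finite-dimensional submodule \<open>W\<close> and a complete list of irreducibles of a finite group, such a
  decomposition exists and this number does not depend on it (Maschke, Krull-Schmidt).\<close>

definition multiplicity_in ::
    "('g, 'm) monoid_scheme \<Rightarrow> (complex \<Rightarrow> 'v::ab_group_add \<Rightarrow> 'v) \<Rightarrow> ('g \<Rightarrow> 'v \<Rightarrow> 'v) \<Rightarrow>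
     nat \<Rightarrow> (nat \<Rightarrow> 'g \<Rightarrow> complex mat) \<Rightarrow> 'v set \<Rightarrow> nat \<Rightarrow> nat" where
  "multiplicity_in G smul act t \<rho> W i =
     (THE m. \<exists>k. affords G smul act W (direct_sum_reps t \<rho> k) \<and> k i = m)"

definition upper_half_plane :: "complex set" where
  "upper_half_plane = {\<tau>. Im \<tau> > 0}"

definition nome :: "complex \<Rightarrow> complex" where
  "nome \<tau> = exp (2 * of_real pi * \<i> * \<tau>)"

definition SL2Z :: "int mat monoid" where
  "SL2Z = \<lparr>carrier = {A \<in> carrier_mat 2 2. Determinant.det A = 1}, mult = (*), one = 1\<^sub>m 2\<rparr>"

definition principal_congruence_subgroup :: "nat \<Rightarrow> int mat set" where
  "principal_congruence_subgroup N =
     {A \<in> carrier SL2Z. \<forall>i<2. \<forall>j<2. int N dvd A $$ (i, j) - 1\<^sub>m 2 $$ (i, j)}"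

definition congruence_subgroup :: "int mat set \<Rightarrow> bool" where
  "congruence_subgroup \<Gamma> \<longleftrightarrow>
     subgroup \<Gamma> SL2Z \<and> (\<exists>N>0. principal_congruence_subgroup N \<subseteq> \<Gamma>)"

definition moebius_act :: "int mat \<Rightarrow> complex \<Rightarrow> complex" where
  "moebius_act A \<tau> =
     (of_int (A $$ (0, 0)) * \<tau> + of_int (A $$ (0, 1))) /
     (of_int (A $$ (1, 0)) * \<tau> + of_int (A $$ (1, 1)))"

text \<open>The cusps are the images of \<open>\<infinity>\<close> under \<open>SL2Z\<close>. For every \<open>A\<close> in \<open>SL2Z\<close>, the function
  \<open>f \<circ> A\<close> must be a function \<open>F\<close> of the local parameter \<open>exp (2 \<pi> i \<tau> / h)\<close>, where \<open>F\<close> is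
  meromorphic at 0.\<close>

definition meromorphic_at_cusps :: "(complex \<Rightarrow> complex) \<Rightarrow> bool" where
  "meromorphic_at_cusps f \<longleftrightarrow>
     (\<forall>A\<in>carrier SL2Z. \<exists>h::nat. h > 0 \<and>
        (\<exists>F. F meromorphic_on {0} \<and>
             (\<forall>\<tau>\<in>upper_half_plane. f (moebius_act A \<tau>) = F (nome (\<tau> / of_nat h)))))"

definition weakly_holomorphic_modular_function :: "(complex \<Rightarrow> complex) \<Rightarrow> bool" where
  "weakly_holomorphic_modular_function f \<longleftrightarrow>
     f holomorphic_on upper_half_plane \<and>
     (\<exists>\<Gamma>. congruence_subgroup \<Gamma> \<and>
          (\<forall>A\<in>\<Gamma>. \<forall>\<tau>\<in>upper_half_plane. f (moebius_act A \<tau>) = f \<tau>)) \<and>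
     meromorphic_at_cusps f"

definition q_series_converges :: "int \<Rightarrow> (int \<Rightarrow> complex) \<Rightarrow> bool" where
  "q_series_converges d a \<longleftrightarrow>
     (\<forall>\<tau>\<in>upper_half_plane. (\<lambda>n. a n * nome \<tau> powi n) summable_on grading_degrees d)"

definition q_series :: "int \<Rightarrow> (int \<Rightarrow> complex) \<Rightarrow> complex \<Rightarrow> complex" where
  "q_series d a \<tau> = (\<Sum>\<^sub>\<infinity>n\<in>grading_degrees d. a n * nome \<tau> powi n)"

definition frob_coeff ::
    "('g, 'm) monoid_scheme \<Rightarrow> (complex \<Rightarrow> 'v::ab_group_add \<Rightarrow> 'v) \<Rightarrow> ('g \<Rightarrow> 'v \<Rightarrow> 'v) \<Rightarrow>
     (int \<Rightarrow> 'v set) \<Rightarrow> nat \<Rightarrow> (nat \<Rightarrow> 'g \<Rightarrow> complex mat) \<Rightarrow> 'g list \<Rightarrow> int \<Rightarrow> complex" where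
  "frob_coeff G smul act V t \<rho> gs n =
     (\<Sum>i=1..t. of_nat (multiplicity_in G smul act t \<rho> (V n) i) * frob_char G (character (\<rho> i)) gs)"

text \<open>The width \<open>r\<close> is the length of \<open>gs\<close>.\<close>

definition mckay_thompson ::
    "('g, 'm) monoid_scheme \<Rightarrow> (complex \<Rightarrow> 'v::ab_group_add \<Rightarrow> 'v) \<Rightarrow> ('g \<Rightarrow> 'v \<Rightarrow> 'v) \<Rightarrow>
     (int \<Rightarrow> 'v set) \<Rightarrow> int \<Rightarrow> nat \<Rightarrow> (nat \<Rightarrow> 'g \<Rightarrow> complex mat) \<Rightarrow> 'g list \<Rightarrow> complex \<Rightarrow> complex" where
  "mckay_thompson G smul act V d t \<rho> gs = q_series d (frob_coeff G smul act V t \<rho> gs)"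

text \<open>That a McKay-Thompson series is a function on the upper half-plane at all includes its
  convergence there.\<close>

definition weak_moonshine ::
    "nat \<Rightarrow> ('g, 'm) monoid_scheme \<Rightarrow> (complex \<Rightarrow> 'v::ab_group_add \<Rightarrow> 'v) \<Rightarrow> ('g \<Rightarrow> 'v \<Rightarrow> 'v) \<Rightarrow>
     (int \<Rightarrow> 'v set) \<Rightarrow> int \<Rightarrow> nat \<Rightarrow> (nat \<Rightarrow> 'g \<Rightarrow> complex mat) \<Rightarrow> bool" where
  "weak_moonshine s G smul act V d t \<rho> \<longleftrightarrow>
     (\<forall>r\<in>{1..s}. \<forall>gs\<in>group_tuples G r.
        q_series_converges d (frob_coeff G smul act V t \<rho> gs) \<and>
        weakly_holomorphic_modular_function (mckay_thompson G smul act V d t \<rho> gs))"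

definition mult_coeff ::
    "('g, 'm) monoid_scheme \<Rightarrow> (complex \<Rightarrow> 'v::ab_group_add \<Rightarrow> 'v) \<Rightarrow> ('g \<Rightarrow> 'v \<Rightarrow> 'v) \<Rightarrow>
     (int \<Rightarrow> 'v set) \<Rightarrow> nat \<Rightarrow> (nat \<Rightarrow> 'g \<Rightarrow> complex mat) \<Rightarrow> nat \<Rightarrow> int \<Rightarrow> complex" where
  "mult_coeff G smul act V t \<rho> i n = of_nat (multiplicity_in G smul act t \<rho> (V n) i)"

definition mult_gen_fun ::
    "('g, 'm) monoid_scheme \<Rightarrow> (complex \<Rightarrow> 'v::ab_group_add \<Rightarrow> 'v) \<Rightarrow> ('g \<Rightarrow> 'v \<Rightarrow> 'v) \<Rightarrow>
     (int \<Rightarrow> 'v set) \<Rightarrow> int \<Rightarrow> nat \<Rightarrow> (nat \<Rightarrow> 'g \<Rightarrow> complex mat) \<Rightarrow> nat \<Rightarrow> complex \<Rightarrow> complex" where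
  "mult_gen_fun G smul act V d t \<rho> i = q_series d (mult_coeff G smul act V t \<rho> i)"

end

theory Submission
  imports Defs "Jordan_Normal_Form.Spectral_Radius" "Jordan_Normal_Form.Matrix_Kernel"
begin

text \<open>The multiplicities enter only linearly, so the theorem amounts to the orthogonality of the
  Frobenius \<open>r\<close>-characters \<open>\<chi>\<^sub>r\<close>. With \<open>c = |G| / dim \<chi>\<close>, Schur orthogonality gives
  \<open>\<Sum>\<^sub>x \<chi>(x a) f(x\<^sup>-\<^sup>1 b) = c f(a b)\<close> and \<open>\<Sum>\<^sub>x f(x a x\<^sup>-\<^sup>1 b) = c \<chi>(a) f(b)\<close> for every linear combination \<open>f\<close>
  of matrix coefficients. Since \<open>\<chi>\<^sub>r\<close> is symmetric and is such an \<open>f\<close> in each variable, induction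
  on \<open>r\<close> yields \<open>\<Sum>\<^sub>x \<chi>\<^sub>r(x a, x\<^sup>-\<^sup>1 b, \<dots>) = - c \<chi>\<^sub>r(a, b, \<dots>)\<close>. Expanding one factor of
  \<open>\<Sum> cnj (\<chi>\<^sub>r) \<chi>\<^sub>r\<close> by the recursion and using \<open>\<chi>\<^sub>r(1, \<dots>) = (dim \<chi> - (r - 1)) \<chi>\<^bsub>r-1\<^esub>(\<dots>)\<close>
  shows that passing from \<open>r - 1\<close> to \<open>r\<close> multiplies the norm by \<open>r c (dim \<chi> - (r - 1))\<close>.\<close>

section \<open>Schur's lemma\<close>

lemma subspace_module_vecI:
  assumes "W \<subseteq> carrier_vec n" and "0\<^sub>v n \<in> W"
    and "\<And>v w. v \<in> W \<Longrightarrow> w \<in> W \<Longrightarrow> v + w \<in> W"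
    and "\<And>c v. v \<in> W \<Longrightarrow> c \<cdot>\<^sub>v v \<in> W"
  shows "VectorSpace.subspace class_ring W (module_vec TYPE('a :: field) n)"
proof -
  interpret vec_space "TYPE('a)" n .
  show ?thesis
    unfolding VectorSpace.subspace_def
    by (intro conjI vectorspace_axioms submodule.intro module_axioms)
      (use assms in \<open>auto simp: module_vec_simps\<close>)
qed

lemma mult_mat_vec_unit:
  fixes T :: "'a :: comm_ring_1 mat"
  assumes "T \<in> carrier_mat m n" and "j < n"
  shows "T *\<^sub>v unit_vec n j = col T j"
  using assms by (intro eq_vecI) auto

lemma mat_kernel_eq_carrier_imp_zero:
  fixes T :: "'a :: comm_ring_1 mat"
  assumes T: "T \<in> carrier_mat m n" and ker: "mat_kernel T = carrier_vec n"
  shows "T = 0\<^sub>m m n"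
proof (rule eq_matI)
  fix i j assume ij: "i < dim_row (0\<^sub>m m n :: 'a mat)" "j < dim_col (0\<^sub>m m n :: 'a mat)"
  then have "unit_vec n j \<in> mat_kernel T" by (simp add: ker)
  then have "T *\<^sub>v unit_vec n j = 0\<^sub>v m" using mat_kernelD[OF T] by blast
  then have "col T j = 0\<^sub>v m" using T ij by (simp add: mult_mat_vec_unit)
  then have "vec_index (col T j) i = 0" using ij by auto
  then show "T $$ (i, j) = 0\<^sub>m m n $$ (i, j)" using T ij by auto
qed (use T in auto)

lemma irreducible_rep_mat:
  assumes "irreducible_rep G n R"
  shows "g \<in> carrier G \<Longrightarrow> R g \<in> carrier_mat n n" and "R \<one>\<^bsub>G\<^esub> = 1\<^sub>m n"
    and "g \<in> carrier G \<Longrightarrow> h \<in> carrier G \<Longrightarrow> R (g \<otimes>\<^bsub>G\<^esub> h) = R g * R h" and "n > 0"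
  using assms by (auto simp: irreducible_rep_def matrix_rep_def)

lemma irreducible_repD:
  assumes "irreducible_rep G n R" and "W \<subseteq> carrier_vec n" and "0\<^sub>v n \<in> W"
    and "\<And>v w. v \<in> W \<Longrightarrow> w \<in> W \<Longrightarrow> v + w \<in> W"
    and "\<And>c v. v \<in> W \<Longrightarrow> c \<cdot>\<^sub>v v \<in> W"
    and "\<And>g w. g \<in> carrier G \<Longrightarrow> w \<in> W \<Longrightarrow> R g *\<^sub>v w \<in> W"
  shows "W = {0\<^sub>v n} \<or> W = carrier_vec n"
  using assms(1,6) subspace_module_vecI[OF assms(2-5)] by (auto simp: irreducible_rep_def)

text \<open>The relation \<open>T * R h = S h * T\<close> makes the kernel of \<open>T\<close>
  invariant under \<open>R\<close>. \<open>S\<close> may be any family of matrices, so that in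
  \<open>character_inv\<close> it can be the conjugate dual without a proof of
  multiplicativity.\<close>

lemma irreducible_rep_kernel:
  assumes irr: "irreducible_rep G n R" and T: "T \<in> carrier_mat m n"
    and S: "\<And>h. h \<in> carrier G \<Longrightarrow> S h \<in> carrier_mat m m"
    and TS: "\<And>h. h \<in> carrier G \<Longrightarrow> T * R h = S h * T"
  shows "mat_kernel T = {0\<^sub>v n} \<or> T = 0\<^sub>m m n"
proof -
  have "mat_kernel T = {0\<^sub>v n} \<or> mat_kernel T = carrier_vec n"
  proof (rule irreducible_repD[OF irr])
    show "mat_kernel T \<subseteq> carrier_vec n" by (rule mat_kernel_carrier[OF T])
    show "0\<^sub>v n \<in> mat_kernel T" using T by (intro mat_kernelI[OF T]) auto
    fix v assume "v \<in> mat_kernel T"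
    then have v: "v \<in> carrier_vec n" "T *\<^sub>v v = 0\<^sub>v m" using mat_kernelD[OF T] by auto
    show "c \<cdot>\<^sub>v v \<in> mat_kernel T" for c
      using v T by (intro mat_kernelI[OF T]) (auto simp: mult_mat_vec)
    show "v + w \<in> mat_kernel T" if "w \<in> mat_kernel T" for w
      using mat_kernelD[OF T that] v T
      by (intro mat_kernelI[OF T]) (auto simp: mult_add_distrib_mat_vec)
    fix g assume g: "g \<in> carrier G"
    note Rg = irreducible_rep_mat(1)[OF irr g]
    have "T *\<^sub>v (R g *\<^sub>v v) = S g *\<^sub>v (T *\<^sub>v v)"
      unfolding assoc_mult_mat_vec[OF T Rg v(1), symmetric] TS[OF g]
      by (rule assoc_mult_mat_vec[OF S[OF g] T v(1)])
    also have "\<dots> = 0\<^sub>v m" using v S[OF g] by auto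
    finally show "R g *\<^sub>v v \<in> mat_kernel T" using v Rg by (intro mat_kernelI[OF T]) auto
  qed
  then show ?thesis using mat_kernel_eq_carrier_imp_zero[OF T] by blast
qed

text \<open>Over the complex numbers \<open>T\<close> has an eigenvalue \<open>k\<close>. Then
  \<open>T - k\<close> still commutes with \<open>R\<close> and has an eigenvector in its kernel, so
  that by irreducibility it is zero.\<close>

lemma Schur_scalar:
  assumes irr: "irreducible_rep G n R" and T: "T \<in> carrier_mat n n"
    and comm: "\<And>h. h \<in> carrier G \<Longrightarrow> T * R h = R h * T"
  shows "\<exists>k. T = k \<cdot>\<^sub>m 1\<^sub>m n"
proof -
  obtain k where "eigenvalue T k"
    using spectrum_non_empty[OF T irreducible_rep_mat(4)[OF irr]] by (auto simp: spectrum_def)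
  then obtain v where v: "v \<in> carrier_vec n" "v \<noteq> 0\<^sub>v n" "char_matrix T k *\<^sub>v v = 0\<^sub>v n"
    using eigenvector_char_matrix[OF T] by (auto simp: eigenvalue_def)
  have K: "char_matrix T k \<in> carrier_mat n n" using T by auto
  have "char_matrix T k * R h = R h * char_matrix T k" if h: "h \<in> carrier G" for h
  proof -
    note Rh = irreducible_rep_mat(1)[OF irr h]
    have "char_matrix T k * R h = T * R h + (- k) \<cdot>\<^sub>m R h"
      using T Rh unfolding char_matrix_def
      by (simp add: add_mult_distrib_mat[of _ n n _ _ n] mult_smult_assoc_mat[of _ n n _ n])
    also have "\<dots> = R h * char_matrix T k"
      using T Rh comm[OF h] unfolding char_matrix_def
      by (simp add: mult_add_distrib_mat[of _ n n _ n] mult_smult_distrib[of _ n n _ n])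
    finally show ?thesis .
  qed
  then have "mat_kernel (char_matrix T k) = {0\<^sub>v n} \<or> char_matrix T k = 0\<^sub>m n n"
    by (intro irreducible_rep_kernel[OF irr K, of R] irreducible_rep_mat(1)[OF irr])
  moreover have "v \<in> mat_kernel (char_matrix T k)" using v by (intro mat_kernelI[OF K]) auto
  ultimately have 0: "char_matrix T k = 0\<^sub>m n n" using v by auto
  have "T $$ (i, j) = (k \<cdot>\<^sub>m 1\<^sub>m n) $$ (i, j)" if "i < n" "j < n" for i j
    using arg_cong[OF 0, of "\<lambda>M. M $$ (i, j)"] that T by (auto simp: char_matrix_def split: if_splits)
  then show ?thesis using T by (intro exI[of _ k] eq_matI) auto
qed

lemma trace_mult_comm:
  fixes A B :: "'a :: comm_semiring_1 mat"
  assumes A: "A \<in> carrier_mat m n" and B: "B \<in> carrier_mat n m"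
  shows "(\<Sum>k<m. (A * B) $$ (k, k)) = (\<Sum>k<n. (B * A) $$ (k, k))"
proof -
  have "(\<Sum>k<m. (A * B) $$ (k, k)) = (\<Sum>k<m. \<Sum>l<n. A $$ (k, l) * B $$ (l, k))"
    using A B by (intro sum.cong) (auto simp: scalar_prod_def atLeast0LessThan)
  also have "\<dots> = (\<Sum>l<n. \<Sum>k<m. B $$ (l, k) * A $$ (k, l))"
    by (subst sum.swap) (simp add: mult.commute)
  also have "\<dots> = (\<Sum>l<n. (B * A) $$ (l, l))"
    using A B by (intro sum.cong) (auto simp: scalar_prod_def atLeast0LessThan)
  finally show ?thesis .
qed

text \<open>For nonzero \<open>T\<close> the kernel is trivial and the image is an invariant
  subspace other than zero, hence everything. Thus \<open>T\<close> is invertible, and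
  \<open>T\<close> with its inverse witnesses the excluded equivalence.\<close>

lemma Schur_zero:
  assumes irr1: "irreducible_rep G n1 R1" and irr2: "irreducible_rep G n2 R2"
    and T: "T \<in> carrier_mat n1 n2"
    and comm: "\<And>h. h \<in> carrier G \<Longrightarrow> T * R2 h = R1 h * T"
    and neq: "\<not> equivalent_reps G R1 R2"
  shows "T = 0\<^sub>m n1 n2"
proof (rule ccontr)
  assume nz: "T \<noteq> 0\<^sub>m n1 n2"
  then have ker: "mat_kernel T = {0\<^sub>v n2}"
    using irreducible_rep_kernel[OF irr2 T, of R1] irreducible_rep_mat(1)[OF irr1] comm by blast
  have inj: "v = w" if "T *\<^sub>v v = T *\<^sub>v w" "v \<in> carrier_vec n2" "w \<in> carrier_vec n2" for v w
  proof -
    have "T *\<^sub>v (v - w) = 0\<^sub>v n1"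
      using that T by (auto simp: mult_minus_distrib_mat_vec)
    then have "v - w \<in> mat_kernel T" using that by (intro mat_kernelI[OF T]) auto
    then have "v - w = 0\<^sub>v n2" using ker by auto
    show ?thesis
    proof (rule eq_vecI)
      fix i assume "i < dim_vec w"
      then show "vec_index v i = vec_index w i"
        using arg_cong[OF \<open>v - w = 0\<^sub>v n2\<close>, of "\<lambda>u. vec_index u i"] that by auto
    qed (use that in auto)
  qed
  define W where "W = (\<lambda>v. T *\<^sub>v v) ` carrier_vec n2"
  have "W = {0\<^sub>v n1} \<or> W = carrier_vec n1"
  proof (rule irreducible_repD[OF irr1])
    show "W \<subseteq> carrier_vec n1" using T by (auto simp: W_def)
    show "0\<^sub>v n1 \<in> W" unfolding W_def using T by (intro image_eqI[of _ _ "0\<^sub>v n2"]) auto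
    fix v assume "v \<in> W"
    then obtain v' where v: "v = T *\<^sub>v v'" "v' \<in> carrier_vec n2" by (auto simp: W_def)
    show "c \<cdot>\<^sub>v v \<in> W" for c
      unfolding W_def using v T by (intro image_eqI[of _ _ "c \<cdot>\<^sub>v v'"]) (auto simp: mult_mat_vec)
    show "v + w \<in> W" if "w \<in> W" for w
    proof -
      obtain w' where "w = T *\<^sub>v w'" "w' \<in> carrier_vec n2" using \<open>w \<in> W\<close> by (auto simp: W_def)
      then show ?thesis unfolding W_def using v T
        by (intro image_eqI[of _ _ "v' + w'"]) (auto simp: mult_add_distrib_mat_vec)
    qed
    fix g assume g: "g \<in> carrier G"
    note Rg = irreducible_rep_mat(1)[OF irr1 g] irreducible_rep_mat(1)[OF irr2 g]
    have "R1 g *\<^sub>v v = T *\<^sub>v (R2 g *\<^sub>v v')"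
      unfolding v(1) assoc_mult_mat_vec[OF Rg(1) T v(2), symmetric] comm[OF g, symmetric]
      by (rule assoc_mult_mat_vec[OF T Rg(2) v(2)])
    then show "R1 g *\<^sub>v v \<in> W" unfolding W_def using v Rg by auto
  qed
  moreover have "W \<noteq> {0\<^sub>v n1}"
  proof
    assume "W = {0\<^sub>v n1}"
    then have "mat_kernel T = carrier_vec n2" unfolding mat_kernel[OF T] by (auto simp: W_def)
    then show False using nz mat_kernel_eq_carrier_imp_zero[OF T] by blast
  qed
  ultimately have "W = carrier_vec n1" by blast
  then have "\<forall>v\<in>carrier_vec n1. \<exists>w\<in>carrier_vec n2. T *\<^sub>v w = v" unfolding W_def by (metis imageE)
  then obtain f where f: "\<And>v. v \<in> carrier_vec n1 \<Longrightarrow> f v \<in> carrier_vec n2 \<and> T *\<^sub>v f v = v"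
    by metis
  \<comment> \<open>The columns of \<open>S\<close> are chosen preimages of the standard basis,
    which makes \<open>S\<close> a right inverse of \<open>T\<close>; injectivity of
    \<open>T\<close> makes it a left inverse too.\<close>
  define S where "S = mat_of_cols n2 (map (\<lambda>j. f (unit_vec n1 j)) [0..<n1])"
  have S: "S \<in> carrier_mat n2 n1" by (auto simp: S_def)
  have colS: "col S j = f (unit_vec n1 j)" if "j < n1" for j
    using that f by (auto simp: S_def)
  have TS: "T * S = 1\<^sub>m n1"
  proof (rule mat_col_eqI)
    fix j assume "j < dim_col (1\<^sub>m n1 :: complex mat)"
    then show "col (T * S) j = col (1\<^sub>m n1) j"
      using T S f by (subst col_mult2[OF T S]) (auto simp: colS)
  qed (use T S in auto)
  have ST: "S * T = 1\<^sub>m n2"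
  proof (rule mat_col_eqI)
    fix j assume "j < dim_col (1\<^sub>m n2 :: complex mat)"
    then have j: "j < n2" by simp
    have "T *\<^sub>v (S *\<^sub>v col T j) = (T * S) *\<^sub>v col T j"
      using T S by (intro assoc_mult_mat_vec[symmetric]) auto
    also have "\<dots> = T *\<^sub>v unit_vec n2 j" using T j TS mult_mat_vec_unit[OF T j] by simp
    finally have "S *\<^sub>v col T j = unit_vec n2 j"
      by (rule inj) (use T S in auto)
    then show "col (S * T) j = col (1\<^sub>m n2) j" using j by (subst col_mult2[OF S T j]) simp
  qed (use T S in auto)
  \<comment> \<open>The two traces are the complex numbers \<open>n1\<close> and \<open>n2\<close>,
    so in characteristic zero the dimensions agree.\<close>
  have "(\<Sum>k<n1. (T * S) $$ (k, k)) = (\<Sum>k<n2. (S * T) $$ (k, k))" by (rule trace_mult_comm[OF T S])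
  then have n: "n1 = n2" by (simp add: TS ST)
  have "similar_mat_wit (R1 g) (R2 g) T S" if g: "g \<in> carrier G" for g
  proof (rule similar_mat_witI[of _ _ n1])
    note Rg = irreducible_rep_mat(1)[OF irr1 g] irreducible_rep_mat(1)[OF irr2 g]
    have "T * R2 g * S = R1 g * T * S" using comm[OF g] by simp
    also have "\<dots> = R1 g * (T * S)" using Rg T S by (intro assoc_mult_mat) auto
    also have "\<dots> = R1 g" using Rg by (simp add: TS)
    finally show "R1 g = T * R2 g * S" ..
  qed (use TS ST T S n irreducible_rep_mat(1)[OF irr1 g] irreducible_rep_mat(1)[OF irr2 g] in auto)
  then show False using neq by (auto simp: equivalent_reps_def)
qed

section \<open>Schur orthogonality\<close>

locale finite_group = group G for G :: "('g, 'm) monoid_scheme" (structure) +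
  assumes finite_carrier [simp]: "finite (carrier G)"
begin

lemma sum_translate_left:
  assumes "h \<in> carrier G"
  shows "(\<Sum>g\<in>carrier G. f (h \<otimes> g)) = (\<Sum>g\<in>carrier G. f g)"
  by (rule sum.reindex_bij_witness[of _ "\<lambda>g. inv h \<otimes> g" "\<lambda>g. h \<otimes> g"])
    (use assms in \<open>auto simp: m_assoc[symmetric]\<close>)

lemma sum_translate_right:
  assumes "h \<in> carrier G"
  shows "(\<Sum>g\<in>carrier G. f (g \<otimes> h)) = (\<Sum>g\<in>carrier G. f g)"
  by (rule sum.reindex_bij_witness[of _ "\<lambda>g. g \<otimes> inv h" "\<lambda>g. g \<otimes> h"])
    (use assms in \<open>auto simp: m_assoc\<close>)

lemma sum_inverse: "(\<Sum>g\<in>carrier G. f (inv g)) = (\<Sum>g\<in>carrier G. f g)"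
  by (rule sum.reindex_bij_witness[of _ "\<lambda>g. inv g" "\<lambda>g. inv g"]) auto

text \<open>This is the sum over \<open>g\<close> of \<open>R1 g * E * R2 (inv g)\<close>, where
  \<open>E\<close> is the matrix unit with its 1 at \<open>(b, c)\<close>; it is not divided by the
  group order.\<close>

definition averaged_matrix_unit ::
    "nat \<Rightarrow> nat \<Rightarrow> ('g \<Rightarrow> complex mat) \<Rightarrow> ('g \<Rightarrow> complex mat) \<Rightarrow> nat \<Rightarrow> nat \<Rightarrow> complex mat" where
  "averaged_matrix_unit n1 n2 R1 R2 b c =
     mat n1 n2 (\<lambda>(a, e). \<Sum>g\<in>carrier G. R1 g $$ (a, b) * R2 (inv g) $$ (c, e))"

lemma averaged_matrix_unit_carrier [simp]:
  "averaged_matrix_unit n1 n2 R1 R2 b c \<in> carrier_mat n1 n2"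
  by (simp add: averaged_matrix_unit_def)

lemma rep_mult_index:
  assumes "irreducible_rep G n R" "g \<in> carrier G" "h \<in> carrier G" "a < n" "b < n"
  shows "R (g \<otimes> h) $$ (a, b) = (\<Sum>s<n. R g $$ (a, s) * R h $$ (s, b))"
proof -
  note R = irreducible_rep_mat[OF assms(1)]
  show ?thesis
    using R(1)[OF assms(2)] R(1)[OF assms(3)] assms(4,5)
    by (simp add: R(3)[OF assms(2,3)] scalar_prod_def atLeast0LessThan)
qed

lemma averaged_matrix_unit_intertwines:
  assumes irr1: "irreducible_rep G n1 R1" and irr2: "irreducible_rep G n2 R2"
    and b: "b < n1" and c: "c < n2" and h: "h \<in> carrier G"
  shows "averaged_matrix_unit n1 n2 R1 R2 b c * R2 h = R1 h * averaged_matrix_unit n1 n2 R1 R2 b c"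
    (is "?T * _ = _ * _")
proof (rule eq_matI)
  note Rh = irreducible_rep_mat(1)[OF irr1 h] irreducible_rep_mat(1)[OF irr2 h]
  fix a e assume "a < dim_row (R1 h * ?T)" "e < dim_col (R1 h * ?T)"
  then have ae: "a < n1" "e < n2" using Rh by (auto simp: averaged_matrix_unit_def)
  have "(?T * R2 h) $$ (a, e) =
      (\<Sum>s<n2. (\<Sum>g\<in>carrier G. R1 g $$ (a, b) * R2 (inv g) $$ (c, s)) * R2 h $$ (s, e))"
    using ae Rh by (auto simp: averaged_matrix_unit_def scalar_prod_def atLeast0LessThan intro!: sum.cong)
  also have "\<dots> = (\<Sum>g\<in>carrier G. R1 g $$ (a, b) * (\<Sum>s<n2. R2 (inv g) $$ (c, s) * R2 h $$ (s, e)))"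
    by (subst sum_distrib_right, subst sum.swap) (simp add: sum_distrib_left mult.assoc)
  also have "\<dots> = (\<Sum>g\<in>carrier G. R1 g $$ (a, b) * R2 (inv g \<otimes> h) $$ (c, e))"
    using ae c h by (intro sum.cong) (simp_all add: rep_mult_index[OF irr2])
  \<comment> \<open>Translating the summation variable by \<open>h\<close> cancels \<open>h\<close>
    in the second factor and makes it appear on the left in the first.\<close>
  also have "\<dots> = (\<Sum>g\<in>carrier G. R1 (h \<otimes> g) $$ (a, b) * R2 (inv (h \<otimes> g) \<otimes> h) $$ (c, e))"
    using h by (rule sum_translate_left[symmetric])
  also have "\<dots> = (\<Sum>g\<in>carrier G. R1 (h \<otimes> g) $$ (a, b) * R2 (inv g) $$ (c, e))"
    using h by (intro sum.cong) (auto simp: inv_mult_group m_assoc)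
  also have "\<dots> = (\<Sum>g\<in>carrier G. (\<Sum>s<n1. R1 h $$ (a, s) * R1 g $$ (s, b)) * R2 (inv g) $$ (c, e))"
    using ae b h by (intro sum.cong) (simp_all add: rep_mult_index[OF irr1])
  also have "\<dots> = (\<Sum>s<n1. R1 h $$ (a, s) * (\<Sum>g\<in>carrier G. R1 g $$ (s, b) * R2 (inv g) $$ (c, e)))"
    by (subst sum_distrib_right, subst sum.swap) (simp add: sum_distrib_left mult.assoc)
  also have "\<dots> = (R1 h * ?T) $$ (a, e)"
    using ae Rh by (auto simp: averaged_matrix_unit_def scalar_prod_def atLeast0LessThan intro!: sum.cong)
  finally show "(?T * R2 h) $$ (a, e) = (R1 h * ?T) $$ (a, e)" .
qed (use irreducible_rep_mat(1)[OF irr1 h] irreducible_rep_mat(1)[OF irr2 h] in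
  \<open>auto simp: averaged_matrix_unit_def\<close>)

lemma matrix_coefficients_orthogonal:
  assumes irr1: "irreducible_rep G n1 R1" and irr2: "irreducible_rep G n2 R2"
    and neq: "\<not> equivalent_reps G R1 R2" and "a < n1" "b < n1" "c < n2" "e < n2"
  shows "(\<Sum>g\<in>carrier G. R1 g $$ (a, b) * R2 (inv g) $$ (c, e)) = 0"
proof -
  let ?T = "averaged_matrix_unit n1 n2 R1 R2 b c"
  have "?T = 0\<^sub>m n1 n2"
    by (rule Schur_zero[OF irr1 irr2 _ _ neq])
      (use assms in \<open>auto simp: averaged_matrix_unit_intertwines[OF irr1 irr2]\<close>)
  then have "?T $$ (a, e) = 0" using assms by simp
  then show ?thesis using assms by (simp add: averaged_matrix_unit_def)
qed

lemma matrix_coefficients_orthonormal: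
  assumes irr: "irreducible_rep G n R" and "a < n" "b < n" "c < n" "e < n"
  shows "(\<Sum>g\<in>carrier G. R g $$ (a, b) * R (inv g) $$ (c, e)) =
    (if a = e \<and> b = c then of_nat (order G) / of_nat n else 0)"
proof -
  let ?T = "averaged_matrix_unit n n R R b c"
  have "\<exists>k. ?T = k \<cdot>\<^sub>m 1\<^sub>m n"
    by (rule Schur_scalar[OF irr])
      (use assms in \<open>auto simp: averaged_matrix_unit_intertwines[OF irr irr]\<close>)
  then obtain k where k: "?T = k \<cdot>\<^sub>m 1\<^sub>m n" by blast
  have entry: "(\<Sum>g\<in>carrier G. R g $$ (x, b) * R (inv g) $$ (c, y)) = (if x = y then k else 0)"
    if "x < n" "y < n" for x y
    using arg_cong[OF k, of "\<lambda>M. M $$ (x, y)"] that by (simp add: averaged_matrix_unit_def)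
  \<comment> \<open>The scalar \<open>k\<close> is found from the trace: summing over the diagonal
    multiplies \<open>R (inv g)\<close> by \<open>R g\<close>, which leaves an entry of the identity
    matrix for every \<open>g\<close>.\<close>
  have "of_nat n * k = (\<Sum>x<n. \<Sum>g\<in>carrier G. R g $$ (x, b) * R (inv g) $$ (c, x))"
    by (simp add: entry)
  also have "\<dots> = (\<Sum>g\<in>carrier G. \<Sum>x<n. R (inv g) $$ (c, x) * R g $$ (x, b))"
    by (subst sum.swap) (simp add: mult.commute)
  also have "\<dots> = (\<Sum>g\<in>carrier G. R (inv g \<otimes> g) $$ (c, b))"
    using assms by (intro sum.cong) (simp_all add: rep_mult_index[OF irr, symmetric] del: l_inv)
  also have "\<dots> = (\<Sum>g\<in>carrier G. if b = c then 1 else 0)"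
    using assms by (intro sum.cong) (auto simp: irreducible_rep_mat(2)[OF irr])
  also have "\<dots> = (if b = c then of_nat (order G) else 0)" by (simp add: order_def)
  finally have "k = (if b = c then of_nat (order G) / of_nat n else 0)"
    using irreducible_rep_mat(4)[OF irr] by (auto simp: field_simps split: if_splits)
  then show ?thesis using entry[of a e] assms by simp
qed

section \<open>Character values at inverses\<close>

lemma character_inv:
  assumes irr: "irreducible_rep G n R" and h: "h \<in> carrier G"
  shows "character R (inv h) = cnj (character R h)"
proof -
  note R = irreducible_rep_mat[OF irr]
  \<comment> \<open>The Gram matrix of a \<open>G\<close>-invariant inner product: \<open>H\<close> intertwines \<open>R\<close> with its conjugate
    dual, which makes the two traces agree.\<close>
  define H where "H = mat n n (\<lambda>(a, b). \<Sum>g\<in>carrier G. \<Sum>s<n. cnj (R g $$ (s, a)) * R g $$ (s, b))"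
  define S where "S = (\<lambda>h. mat n n (\<lambda>(a, b). cnj (R (inv h) $$ (b, a))))"
  have H: "H \<in> carrier_mat n n" and S: "S x \<in> carrier_mat n n" for x by (auto simp: H_def S_def)
  have HR: "H * R x = S x * H" if x: "x \<in> carrier G" for x
  proof (rule eq_matI)
    fix a b assume "a < dim_row (S x * H)" "b < dim_col (S x * H)"
    then have ab: "a < n" "b < n" using H S[of x] by auto
    have "(H * R x) $$ (a, b) =
        (\<Sum>u<n. (\<Sum>g\<in>carrier G. \<Sum>s<n. cnj (R g $$ (s, a)) * R g $$ (s, u)) * R x $$ (u, b))"
      using ab R(1)[OF x] by (auto simp: H_def scalar_prod_def atLeast0LessThan intro!: sum.cong)
    also have "\<dots> = (\<Sum>g\<in>carrier G. \<Sum>s<n. \<Sum>u<n. cnj (R g $$ (s, a)) * (R g $$ (s, u) * R x $$ (u, b)))"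
      by (simp only: sum_distrib_right mult.assoc) (subst sum.swap, rule sum.cong, simp, rule sum.swap)
    also have "\<dots> = (\<Sum>g\<in>carrier G. \<Sum>s<n. cnj (R g $$ (s, a)) * R (g \<otimes> x) $$ (s, b))"
      using ab x by (simp add: rep_mult_index[OF irr] sum_distrib_left)
    \<comment> \<open>With \<open>g\<close> written as \<open>g x x^-1\<close>, the summand depends
      on \<open>g x\<close> only, and a right translation removes \<open>x\<close> from the second
      factor.\<close>
    also have "\<dots> = (\<Sum>g\<in>carrier G. \<Sum>s<n. cnj (R (g \<otimes> x \<otimes> inv x) $$ (s, a)) * R (g \<otimes> x) $$ (s, b))"
      using x by (intro sum.cong) (auto simp: m_assoc)
    also have "\<dots> = (\<Sum>g\<in>carrier G. \<Sum>s<n. cnj (R (g \<otimes> inv x) $$ (s, a)) * R g $$ (s, b))"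
      by (rule sum_translate_right[OF x,
        where f = "\<lambda>g. \<Sum>s<n. cnj (R (g \<otimes> inv x) $$ (s, a)) * R g $$ (s, b)"])
    also have "\<dots> = (\<Sum>g\<in>carrier G. \<Sum>s<n. \<Sum>u<n. cnj (R (inv x) $$ (u, a)) * (cnj (R g $$ (s, u)) * R g $$ (s, b)))"
      using ab x by (simp add: rep_mult_index[OF irr] sum_distrib_left sum_distrib_right mult_ac)
    also have "\<dots> = (\<Sum>u<n. cnj (R (inv x) $$ (u, a)) * (\<Sum>g\<in>carrier G. \<Sum>s<n. cnj (R g $$ (s, u)) * R g $$ (s, b)))"
      by (simp only: sum_distrib_left)
        (rule sym, subst sum.swap, rule sum.cong, simp, rule sum.swap)
    also have "\<dots> = (S x * H) $$ (a, b)"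
      using ab by (auto simp: H_def S_def scalar_prod_def atLeast0LessThan intro!: sum.cong)
    finally show "(H * R x) $$ (a, b) = (S x * H) $$ (a, b)" .
  qed (use H S[of x] R(1)[OF x] in auto)
  \<comment> \<open>The entry of \<open>H\<close> at \<open>(0, 0)\<close> is a sum of squared
    absolute values, and the term with \<open>g = 1\<close> and \<open>s = 0\<close> equals
    1.\<close>
  have "H \<noteq> 0\<^sub>m n n"
  proof
    assume "H = 0\<^sub>m n n"
    then have "H $$ (0, 0) = 0" using R(4) by simp
    then have "(\<Sum>g\<in>carrier G. \<Sum>s<n. cnj (R g $$ (s, 0)) * R g $$ (s, 0)) = 0"
      using R(4) by (simp add: H_def)
    then have "complex_of_real (\<Sum>g\<in>carrier G. \<Sum>s<n. (cmod (R g $$ (s, 0)))\<^sup>2) = 0"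
      by (simp add: complex_norm_square mult.commute del: of_real_power)
    then have "(\<Sum>g\<in>carrier G. \<Sum>s<n. (cmod (R g $$ (s, 0)))\<^sup>2) = 0"
      by (simp only: of_real_eq_0_iff)
    then have "(\<Sum>s<n. (cmod (R \<one> $$ (s, 0)))\<^sup>2) = 0"
      by (subst (asm) sum_nonneg_eq_0_iff) (auto intro: sum_nonneg)
    then have "(cmod (R \<one> $$ (0, 0)))\<^sup>2 = 0"
      using R(4) by (subst (asm) sum_nonneg_eq_0_iff) auto
    then show False using R(2,4) by simp
  qed
  then have ker: "mat_kernel H = {0\<^sub>v n}"
    using irreducible_rep_kernel[OF irr H, of S] S HR by blast
  have "det H \<noteq> 0"
    using ker mat_kernelI[OF H] unfolding det_0_iff_vec_prod_zero[OF H] by blast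
  then obtain K where K: "K \<in> carrier_mat n n" "K * H = 1\<^sub>m n" "H * K = 1\<^sub>m n"
    using det_non_zero_imp_unit[OF H, of "()"] by (auto simp: Units_def ring_mat_def)
  \<comment> \<open>As \<open>H\<close> is invertible, \<open>R (inv h)\<close> is conjugate to
    \<open>S (inv h)\<close>, whose diagonal consists of the conjugated diagonal entries of
    \<open>R h\<close>.\<close>
  have Rh: "R (inv h) = K * (S (inv h) * H)"
    using HR[of "inv h", symmetric] h K R(1)[of "inv h"] H by (simp add: assoc_mult_mat[of _ n n _ n _ n, symmetric])
  have "character R (inv h) = (\<Sum>k<n. (K * (S (inv h) * H)) $$ (k, k))"
    using R(1)[of "inv h"] h by (simp add: character_def Rh[symmetric])
  also have "\<dots> = (\<Sum>k<n. (S (inv h) * H * K) $$ (k, k))"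
    using K H S by (intro trace_mult_comm mult_carrier_mat)
  also have "S (inv h) * H * K = S (inv h)"
    using K H S[of "inv h"] by (simp add: assoc_mult_mat[of _ n n _ n _ n])
  also have "(\<Sum>k<n. S (inv h) $$ (k, k)) = cnj (character R h)"
    using h R(1)[OF h] by (simp add: S_def character_def)
  finally show ?thesis .
qed

end

section \<open>Symmetry of Frobenius characters\<close>

text \<open>The value 1 at the empty list makes one recursion cover all widths: for empty
  \<open>ts\<close> it gives \<open>chi g\<close>, for a singleton the formula of width 2.\<close>

lemma frob_char_Cons:
  "frob_char G chi (g # ts) = chi g * frob_char G chi ts -
     (\<Sum>j<length ts. frob_char G chi (ts[j := g \<otimes>\<^bsub>G\<^esub> ts ! j]))"
proof (cases ts)
  case (Cons g2 us)
  then show ?thesis by (cases us) auto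
qed simp

text \<open>After the recursion has been applied to \<open>a\<close> and then to \<open>b\<close>,
  every term either is symmetric in them or has its mirror image among the other terms, except
  \<open>chi (a \<otimes> b)\<close>, where the hypothesis on \<open>chi\<close> enters.\<close>

lemma (in group) frob_char_swap:
  assumes chi: "\<And>g h. g \<in> carrier G \<Longrightarrow> h \<in> carrier G \<Longrightarrow> chi (g \<otimes> h) = chi (h \<otimes> g)"
    and a: "a \<in> carrier G" and b: "b \<in> carrier G" and vs: "set vs \<subseteq> carrier G"
  shows "frob_char G chi (a # b # vs) = frob_char G chi (b # a # vs)"
proof -
  let ?F = "frob_char G chi" and ?m = "length vs"
  \<comment> \<open>The terms in which \<open>a\<close> and \<open>b\<close> are absorbed by two different entries of \<open>vs\<close>.\<close>
  define off where "off = (\<lambda>a b. \<Sum>j<?m. \<Sum>k\<in>{..<?m} - {j}. ?F (vs[j := a \<otimes> vs ! j, k := b \<otimes> vs ! k]))"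
  have off: "off a b = off b a"
  proof -
    have "off a b = (\<Sum>j<?m. \<Sum>k<?m. if j = k then 0 else ?F (vs[j := a \<otimes> vs ! j, k := b \<otimes> vs ! k]))"
      for a b
      unfolding off_def by (intro sum.cong refl sum.mono_neutral_cong_left) auto
    then show ?thesis
      by (simp only:) (subst sum.swap, intro sum.cong, auto simp: list_update_swap)
  qed
  have vsj: "vs ! j \<in> carrier G" if "j < ?m" for j using vs that by auto
  have expand: "?F (a # b # vs) = chi a * chi b * ?F vs - chi a * (\<Sum>j<?m. ?F (vs[j := b \<otimes> vs ! j]))
      - chi (a \<otimes> b) * ?F vs + (\<Sum>j<?m. ?F (vs[j := a \<otimes> b \<otimes> vs ! j]))
      - chi b * (\<Sum>j<?m. ?F (vs[j := a \<otimes> vs ! j]))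
      + (\<Sum>j<?m. ?F (vs[j := b \<otimes> a \<otimes> vs ! j])) + off a b"
    if ab: "a \<in> carrier G" "b \<in> carrier G" for a b
  proof -
    have "(\<Sum>j<?m. ?F (b # vs[j := a \<otimes> vs ! j])) =
        (\<Sum>j<?m. chi b * ?F (vs[j := a \<otimes> vs ! j])
          - (?F (vs[j := b \<otimes> a \<otimes> vs ! j])
             + (\<Sum>k\<in>{..<?m} - {j}. ?F (vs[j := a \<otimes> vs ! j, k := b \<otimes> vs ! k]))))"
    proof (rule sum.cong)
      fix j assume "j \<in> {..<?m}"
      then have j: "j < ?m" by simp
      \<comment> \<open>The index \<open>k = j\<close> is split off: there \<open>b\<close> is
        absorbed by the entry that has already absorbed \<open>a\<close>.\<close>
      have "(\<Sum>k<?m. ?F (vs[j := a \<otimes> vs ! j, k := b \<otimes> vs[j := a \<otimes> vs ! j] ! k])) =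
          ?F (vs[j := b \<otimes> a \<otimes> vs ! j])
            + (\<Sum>k\<in>{..<?m} - {j}. ?F (vs[j := a \<otimes> vs ! j, k := b \<otimes> vs ! k]))"
        using j ab vsj by (subst sum.remove[of _ j]) (auto simp: m_assoc)
      then show "?F (b # vs[j := a \<otimes> vs ! j]) = chi b * ?F (vs[j := a \<otimes> vs ! j])
          - (?F (vs[j := b \<otimes> a \<otimes> vs ! j])
             + (\<Sum>k\<in>{..<?m} - {j}. ?F (vs[j := a \<otimes> vs ! j, k := b \<otimes> vs ! k])))"
        by (simp add: frob_char_Cons[of _ _ b])
    qed simp
    then have 2: "(\<Sum>j<?m. ?F (b # vs[j := a \<otimes> vs ! j])) =
        chi b * (\<Sum>j<?m. ?F (vs[j := a \<otimes> vs ! j]))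
          - (\<Sum>j<?m. ?F (vs[j := b \<otimes> a \<otimes> vs ! j])) - off a b"
      by (simp add: sum_subtractf sum.distrib sum_distrib_left off_def)
    \<comment> \<open>The index 0 of the recursion, where \<open>a\<close> is absorbed by
      \<open>b\<close> itself, is separated from the indices that point into
      \<open>vs\<close>.\<close>
    have "?F (a # b # vs) =
        chi a * ?F (b # vs) - ?F ((a \<otimes> b) # vs) - (\<Sum>j<?m. ?F (b # vs[j := a \<otimes> vs ! j]))"
      by (simp only: frob_char_Cons[of _ _ a] list.size sum.lessThan_Suc_shift
          add_Suc_right add_0_right nth_Cons_0 nth_Cons_Suc list_update.simps nat.case) simp
    then show ?thesis
      unfolding 2 frob_char_Cons[of _ _ b vs] frob_char_Cons[of _ _ "a \<otimes> b" vs]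
      by (simp add: algebra_simps)
  qed
  show ?thesis
    by (simp only: expand[OF a b] expand[OF b a] off chi[OF a b]) (simp add: algebra_simps)
qed

text \<open>By symmetry the absorbing entry can be moved to the front, so the sum runs over a
  multiset instead of positions. Symmetry is assumed only at the length of \<open>ts\<close>, which
  makes the recursion available inside the induction that proves symmetry.\<close>

lemma (in group) frob_char_Cons_mset:
  assumes sym: "\<And>us vs. length us = length ts \<Longrightarrow> set us \<subseteq> carrier G \<Longrightarrow> mset us = mset vs \<Longrightarrow>
      frob_char G chi us = frob_char G chi vs"
    and h: "h \<in> carrier G" and ts: "set ts \<subseteq> carrier G"
  shows "frob_char G chi (h # ts) = chi h * frob_char G chi ts -
     (\<Sum>x\<in>#mset ts. frob_char G chi ((h \<otimes> x) # remove1 x ts))"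
proof -
  have "(\<Sum>j<length ts. frob_char G chi (ts[j := h \<otimes> ts ! j])) =
      (\<Sum>j<length ts. frob_char G chi ((h \<otimes> ts ! j) # remove1 (ts ! j) ts))"
  proof (intro sum.cong sym)
    fix j assume "j \<in> {..<length ts}"
    then have j: "j < length ts" "ts ! j \<in> carrier G" using ts by auto
    then show "set (ts[j := h \<otimes> ts ! j]) \<subseteq> carrier G"
      using ts h set_update_subset_insert[of ts j "h \<otimes> ts ! j"] by auto
    show "mset (ts[j := h \<otimes> ts ! j]) = mset ((h \<otimes> ts ! j) # remove1 (ts ! j) ts)"
      using j by (simp add: mset_update)
  qed auto
  also have "\<dots> = (\<Sum>x\<leftarrow>ts. frob_char G chi ((h \<otimes> x) # remove1 x ts))"
    by (simp add: sum_list_sum_nth atLeast0LessThan)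
  also have "\<dots> = (\<Sum>x\<in>#mset ts. frob_char G chi ((h \<otimes> x) # remove1 x ts))"
    by (simp only: mset_map[symmetric] sum_mset_sum_list)
  finally show ?thesis by (simp only: frob_char_Cons[of G chi h ts])
qed

text \<open>Exchanging the first two entries and permuting the tail generate all permutations. The
  exchange is \<open>frob_char_swap\<close>; permuting the tail is reduced to the induction
  hypothesis.\<close>

lemma (in group) frob_char_mset_cong:
  assumes chi: "\<And>g h. g \<in> carrier G \<Longrightarrow> h \<in> carrier G \<Longrightarrow> chi (g \<otimes> h) = chi (h \<otimes> g)"
    and "set us \<subseteq> carrier G" and "mset us = mset vs"
  shows "frob_char G chi us = frob_char G chi vs"
  using assms(2,3)
proof (induction "length us" arbitrary: us vs)
  case 0
  then show ?case by simp
next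
  case (Suc m)
  let ?F = "frob_char G chi"
  have sym: "?F xs = ?F ys" if "length xs = m" "set xs \<subseteq> carrier G" "mset xs = mset ys" for xs ys
    using Suc.hyps(1)[of xs ys] that by simp
  \<comment> \<open>The recursion leads from \<open>h # xs\<close> to lists of length
    \<open>m\<close> only, which the induction hypothesis allows to be reordered.\<close>
  have tail: "?F (h # xs) = ?F (h # ys)"
    if h: "h \<in> carrier G" and xs: "length xs = m" "set xs \<subseteq> carrier G" "mset xs = mset ys" for h xs ys
  proof -
    have ys: "length ys = m" "set ys \<subseteq> carrier G"
      using xs mset_eq_length[OF xs(3)] mset_eq_setD[OF xs(3)] by auto
    have eq: "(\<Sum>x\<in>#mset xs. ?F ((h \<otimes> x) # remove1 x xs)) = (\<Sum>x\<in>#mset xs. ?F ((h \<otimes> x) # remove1 x ys))"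
    proof (rule arg_cong[of _ _ sum_mset], rule image_mset_cong, rule sym)
      fix x assume "x \<in># mset xs"
      then have x: "x \<in> set xs" by simp
      show "length ((h \<otimes> x) # remove1 x xs) = m" using x xs(1) by (cases m) (auto simp: length_remove1)
      show "set ((h \<otimes> x) # remove1 x xs) \<subseteq> carrier G"
        using x h xs(2) set_remove1_subset[of x xs] by auto
    qed (simp add: xs)
    have expand: "?F (h # zs) = chi h * ?F zs - (\<Sum>x\<in>#mset zs. ?F ((h \<otimes> x) # remove1 x zs))"
      if "length zs = m" "set zs \<subseteq> carrier G" for zs
      by (rule frob_char_Cons_mset[OF _ h that(2)], rule sym) (simp_all add: that(1))
    show ?thesis
      unfolding expand[OF xs(1,2)] expand[OF ys] sym[OF xs] eq by (simp only: xs(3))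
  qed
  obtain a ts where us: "us = a # ts" "length ts = m" using Suc.hyps(2) by (metis length_Suc_conv)
  obtain b ts' where vs: "vs = b # ts'" using us(1) Suc.prems(2) by (cases vs) auto
  have a: "a \<in> carrier G" and ts: "set ts \<subseteq> carrier G" using Suc.prems us by auto
  show ?case
  proof (cases "a = b")
    case True
    then show ?thesis using tail[OF a us(2) ts, of ts'] Suc.prems(2) us vs by simp
  next
    case False
    have eq: "add_mset a (mset ts) = add_mset b (mset ts')" using Suc.prems(2) us vs by simp
    then have "b \<in># mset ts" using False by (metis insert_noteq_member)
    then have bts: "b \<in> set ts" by simp
    then have b: "b \<in> carrier G" using ts by auto
    \<comment> \<open>With \<open>ws\<close> the common rest, the lists are linked by
      \<open>a # ts\<close>, \<open>a # b # ws\<close>, \<open>b # a # ws\<close>,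
      \<open>b # ts'\<close>; only the middle link changes the head.\<close>
    define ws where "ws = remove1 b ts"
    have ws: "set ws \<subseteq> carrier G" using ts set_remove1_subset[of b ts] by (auto simp: ws_def)
    have bws: "mset ts = mset (b # ws)" using bts by (simp add: ws_def)
    then have "mset (a # ws) = mset ts'" using eq False by (simp add: add_mset_commute[of a b])
    moreover have "length (a # ws) = m" using bws us(2) by (metis length_Cons mset_eq_length)
    ultimately have "?F (b # a # ws) = ?F vs" using tail[OF b, of "a # ws" ts'] a ws vs by simp
    moreover have "?F us = ?F (a # b # ws)" using tail[OF a us(2) ts bws] us by simp
    moreover have "?F (a # b # ws) = ?F (b # a # ws)"
      by (rule frob_char_swap) (use chi a b ws in auto)
    ultimately show ?thesis by simp
  qed
qed

section \<open>Convolution identities\<close>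

locale irreducible_representation = finite_group G for G :: "('g, 'm) monoid_scheme" (structure) +
  fixes n :: nat and R :: "'g \<Rightarrow> complex mat"
  assumes irr: "irreducible_rep G n R"
begin

abbreviation chi where "chi \<equiv> character R"
abbreviation F where "F \<equiv> frob_char G (character R)"

definition c :: complex where "c = of_nat (order G) / of_nat n"

lemma n_pos: "n > 0"
  by (rule irreducible_rep_mat(4)[OF irr])

lemma c_nonzero: "c \<noteq> 0"
  using n_pos order_gt_0_iff_finite by (auto simp: c_def)

lemma character_eq: "g \<in> carrier G \<Longrightarrow> chi g = (\<Sum>k<n. R g $$ (k, k))"
  using irreducible_rep_mat(1)[OF irr, of g] by (auto simp: character_def)

lemma character_at_one: "chi \<one> = of_nat n"
  by (simp add: character_eq irreducible_rep_mat(2)[OF irr])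

lemma character_commute:
  assumes "g \<in> carrier G" "h \<in> carrier G"
  shows "chi (g \<otimes> h) = chi (h \<otimes> g)"
  using assms trace_mult_comm[OF irreducible_rep_mat(1)[OF irr assms(1)] irreducible_rep_mat(1)[OF irr assms(2)]]
  by (simp add: character_eq irreducible_rep_mat(3)[OF irr])

lemma F_mset_cong:
  assumes "set us \<subseteq> carrier G" and "mset us = mset vs"
  shows "F us = F vs"
  by (rule frob_char_mset_cong) (use character_commute assms in auto)

lemma F_Cons_mset:
  assumes "h \<in> carrier G" and "set ts \<subseteq> carrier G"
  shows "F (h # ts) = chi h * F ts - (\<Sum>x\<in>#mset ts. F ((h \<otimes> x) # remove1 x ts))"
  by (rule frob_char_Cons_mset[OF F_mset_cong assms])

text \<open>The span of the matrix coefficients of \<open>R\<close>, the part of the functions on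
  \<open>G\<close> that belongs to \<open>R\<close>. Identities proved for single entries extend to
  it by linearity, and it contains \<open>F\<close> as a function of its first argument.\<close>

definition coefficient_function :: "('g \<Rightarrow> complex) \<Rightarrow> bool" where
  "coefficient_function f \<longleftrightarrow>
     (\<exists>A. \<forall>g\<in>carrier G. f g = (\<Sum>p<n. \<Sum>q<n. A p q * R g $$ (p, q)))"

lemma coefficient_functionI:
  "(\<And>g. g \<in> carrier G \<Longrightarrow> f g = (\<Sum>p<n. \<Sum>q<n. A p q * R g $$ (p, q))) \<Longrightarrow> coefficient_function f"
  by (auto simp: coefficient_function_def)

lemma coefficient_function_cong:
  assumes "coefficient_function f" and "\<And>g. g \<in> carrier G \<Longrightarrow> f g = f' g"
  shows "coefficient_function f'"
  using assms unfolding coefficient_function_def by metis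

lemma coefficient_function_character: "coefficient_function chi"
  by (rule coefficient_functionI[where A = "\<lambda>p q. if p = q then 1 else 0"])
    (simp add: character_eq if_distrib[of "\<lambda>x. x * _"] cong: if_cong)

lemma coefficient_function_cmult:
  assumes "coefficient_function f"
  shows "coefficient_function (\<lambda>g. f g * k)"
proof -
  obtain A where "\<And>g. g \<in> carrier G \<Longrightarrow> f g = (\<Sum>p<n. \<Sum>q<n. A p q * R g $$ (p, q))"
    using assms by (auto simp: coefficient_function_def)
  then show ?thesis
    by (intro coefficient_functionI[where A = "\<lambda>p q. A p q * k"])
      (simp add: sum_distrib_left sum_distrib_right mult_ac)
qed

lemma coefficient_function_diff:
  assumes "coefficient_function f" and "coefficient_function f'"
  shows "coefficient_function (\<lambda>g. f g - f' g)"
proof -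
  obtain A A' where "\<And>g. g \<in> carrier G \<Longrightarrow> f g = (\<Sum>p<n. \<Sum>q<n. A p q * R g $$ (p, q))"
    and "\<And>g. g \<in> carrier G \<Longrightarrow> f' g = (\<Sum>p<n. \<Sum>q<n. A' p q * R g $$ (p, q))"
    using assms by (auto simp: coefficient_function_def)
  then show ?thesis
    by (intro coefficient_functionI[where A = "\<lambda>p q. A p q - A' p q"])
      (simp add: sum_subtractf left_diff_distrib)
qed

lemma coefficient_function_zero: "coefficient_function (\<lambda>g. 0)"
  by (rule coefficient_functionI[where A = "\<lambda>p q. 0"]) simp

lemma coefficient_function_add:
  assumes "coefficient_function f" and "coefficient_function f'"
  shows "coefficient_function (\<lambda>g. f g + f' g)"
  using coefficient_function_diff[OF assms(1) coefficient_function_diff[OF coefficient_function_zero assms(2)]]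
  by simp

lemma coefficient_function_sum_mset:
  assumes "\<And>x. x \<in># M \<Longrightarrow> coefficient_function (f x)"
  shows "coefficient_function (\<lambda>g. \<Sum>x\<in>#M. f x g)"
  using assms
  by (induction M) (auto intro: coefficient_function_zero coefficient_function_add)

lemma coefficient_function_translate:
  assumes "coefficient_function f" and x: "x \<in> carrier G"
  shows "coefficient_function (\<lambda>g. f (g \<otimes> x))"
proof -
  obtain A where A: "\<And>g. g \<in> carrier G \<Longrightarrow> f g = (\<Sum>p<n. \<Sum>q<n. A p q * R g $$ (p, q))"
    using assms by (auto simp: coefficient_function_def)
  show ?thesis
  proof (rule coefficient_functionI[where A = "\<lambda>p s. \<Sum>q<n. A p q * R x $$ (s, q)"])
    fix g assume g: "g \<in> carrier G"
    have "f (g \<otimes> x) = (\<Sum>p<n. \<Sum>q<n. \<Sum>s<n. A p q * R x $$ (s, q) * R g $$ (p, s))"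
      using g x by (simp add: A rep_mult_index[OF irr] sum_distrib_left mult_ac)
    also have "\<dots> = (\<Sum>p<n. \<Sum>s<n. (\<Sum>q<n. A p q * R x $$ (s, q)) * R g $$ (p, s))"
      unfolding sum_distrib_right by (intro sum.cong refl sum.swap)
    finally show "f (g \<otimes> x) = (\<Sum>p<n. \<Sum>s<n. (\<Sum>q<n. A p q * R x $$ (s, q)) * R g $$ (p, s))" .
  qed
qed

text \<open>The recursion uses \<open>g\<close> only through \<open>chi g\<close> and through right
  translates of shorter instances, so induction on the length applies.\<close>

lemma coefficient_function_F:
  assumes "set ts \<subseteq> carrier G"
  shows "coefficient_function (\<lambda>g. F (g # ts))"
  using assms
proof (induction "length ts" arbitrary: ts rule: less_induct)
  case less
  have "coefficient_function (\<lambda>g. F ((g \<otimes> x) # remove1 x ts))" if "x \<in># mset ts" for x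
  proof -
    have x: "x \<in> set ts" using that by simp
    have "coefficient_function (\<lambda>g. F (g # remove1 x ts))"
    proof (rule less.hyps)
      show "length (remove1 x ts) < length ts"
        using x length_pos_if_in_set[OF x] by (simp add: length_remove1)
      show "set (remove1 x ts) \<subseteq> carrier G" using less.prems set_remove1_subset[of x ts] by auto
    qed
    then show ?thesis using x less.prems by (intro coefficient_function_translate) auto
  qed
  then have "coefficient_function
      (\<lambda>g. chi g * F ts - (\<Sum>x\<in>#mset ts. F ((g \<otimes> x) # remove1 x ts)))"
    by (intro coefficient_function_diff coefficient_function_cmult coefficient_function_character
        coefficient_function_sum_mset)
  then show ?case
    by (rule coefficient_function_cong) (simp add: F_Cons_mset[OF _ less.prems])
qed

text \<open>Common source of the next two identities: \<open>i = j\<close> summed gives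
  \<open>character_convolution\<close>, \<open>j = p\<close> summed gives
  \<open>conjugation_average\<close>. Orthogonality leaves one term of the expanded product.\<close>

lemma coefficients_convolution:
  assumes v: "v \<in> carrier G" and w: "w \<in> carrier G" and ij: "i < n" "j < n" and pq: "p < n" "q < n"
  shows "(\<Sum>x\<in>carrier G. R (x \<otimes> v) $$ (i, j) * R (inv x \<otimes> w) $$ (p, q)) =
    c * R w $$ (i, q) * R v $$ (p, j)"
proof -
  have "(\<Sum>x\<in>carrier G. R (x \<otimes> v) $$ (i, j) * R (inv x \<otimes> w) $$ (p, q)) =
      (\<Sum>x\<in>carrier G. \<Sum>s<n. \<Sum>t<n. R v $$ (s, j) * R w $$ (t, q) * (R x $$ (i, s) * R (inv x) $$ (p, t)))"
    using assms by (simp add: rep_mult_index[OF irr] sum_product mult_ac)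
  also have "\<dots> = (\<Sum>s<n. \<Sum>t<n. R v $$ (s, j) * R w $$ (t, q) * (\<Sum>x\<in>carrier G. R x $$ (i, s) * R (inv x) $$ (p, t)))"
    unfolding sum_distrib_left by (subst sum.swap, rule sum.cong, simp, rule sum.swap)
  also have "\<dots> = (\<Sum>s<n. \<Sum>t<n. if i = t \<and> s = p then c * R w $$ (i, q) * R v $$ (p, j) else 0)"
    using ij pq by (intro sum.cong) (auto simp: matrix_coefficients_orthonormal[OF irr] c_def)
  also have "\<dots> = (\<Sum>s<n. if s = p then c * R w $$ (i, q) * R v $$ (p, j) else 0)"
    using ij by (intro sum.cong refl) auto
  also have "\<dots> = c * R w $$ (i, q) * R v $$ (p, j)" using pq by simp
  finally show ?thesis .
qed

lemma character_convolution:
  assumes f: "coefficient_function f" and a: "a \<in> carrier G" and b: "b \<in> carrier G"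
  shows "(\<Sum>x\<in>carrier G. chi (x \<otimes> a) * f (inv x \<otimes> b)) = c * f (a \<otimes> b)"
proof -
  obtain A where A: "\<And>g. g \<in> carrier G \<Longrightarrow> f g = (\<Sum>p<n. \<Sum>q<n. A p q * R g $$ (p, q))"
    using f by (auto simp: coefficient_function_def)
  have entry: "(\<Sum>x\<in>carrier G. chi (x \<otimes> a) * R (inv x \<otimes> b) $$ (p, q)) = c * R (a \<otimes> b) $$ (p, q)"
    if pq: "p < n" "q < n" for p q
  proof -
    have "(\<Sum>x\<in>carrier G. chi (x \<otimes> a) * R (inv x \<otimes> b) $$ (p, q)) =
        (\<Sum>k<n. \<Sum>x\<in>carrier G. R (x \<otimes> a) $$ (k, k) * R (inv x \<otimes> b) $$ (p, q))"
      by (subst sum.swap) (use a in \<open>simp add: character_eq sum_distrib_right\<close>)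
    also have "\<dots> = (\<Sum>k<n. c * R b $$ (k, q) * R a $$ (p, k))"
      using coefficients_convolution[OF a b] pq by (intro sum.cong) auto
    also have "\<dots> = c * R (a \<otimes> b) $$ (p, q)"
      using a b pq by (simp add: rep_mult_index[OF irr] sum_distrib_left mult_ac)
    finally show ?thesis .
  qed
  have "(\<Sum>x\<in>carrier G. chi (x \<otimes> a) * f (inv x \<otimes> b)) =
      (\<Sum>x\<in>carrier G. \<Sum>p<n. \<Sum>q<n. A p q * (chi (x \<otimes> a) * R (inv x \<otimes> b) $$ (p, q)))"
    using b by (simp add: A sum_distrib_left mult_ac)
  also have "\<dots> = (\<Sum>p<n. \<Sum>q<n. A p q * (\<Sum>x\<in>carrier G. chi (x \<otimes> a) * R (inv x \<otimes> b) $$ (p, q)))"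
    unfolding sum_distrib_left by (subst sum.swap, rule sum.cong, simp, rule sum.swap)
  also have "\<dots> = c * f (a \<otimes> b)" using a b by (simp add: entry A sum_distrib_left mult_ac)
  finally show ?thesis .
qed

text \<open>The sum of the conjugates of \<open>R a\<close> is a scalar matrix, whose scalar
  \<open>c * chi a\<close> is determined by its trace.\<close>

lemma conjugation_average:
  assumes f: "coefficient_function f" and a: "a \<in> carrier G" and b: "b \<in> carrier G"
  shows "(\<Sum>x\<in>carrier G. f (x \<otimes> a \<otimes> (inv x \<otimes> b))) = c * chi a * f b"
proof -
  obtain A where A: "\<And>g. g \<in> carrier G \<Longrightarrow> f g = (\<Sum>p<n. \<Sum>q<n. A p q * R g $$ (p, q))"
    using f by (auto simp: coefficient_function_def)
  have entry: "(\<Sum>x\<in>carrier G. R (x \<otimes> a \<otimes> (inv x \<otimes> b)) $$ (p, q)) = c * chi a * R b $$ (p, q)"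
    if pq: "p < n" "q < n" for p q
  proof -
    have "(\<Sum>x\<in>carrier G. R (x \<otimes> a \<otimes> (inv x \<otimes> b)) $$ (p, q)) =
        (\<Sum>k<n. \<Sum>x\<in>carrier G. R (x \<otimes> a) $$ (p, k) * R (inv x \<otimes> b) $$ (k, q))"
      by (subst sum.swap) (use a b pq in \<open>simp add: rep_mult_index[OF irr, of "_ \<otimes> a"]\<close>)
    also have "\<dots> = (\<Sum>k<n. c * R b $$ (p, q) * R a $$ (k, k))"
      using coefficients_convolution[OF a b] pq by (intro sum.cong) auto
    also have "\<dots> = c * chi a * R b $$ (p, q)"
      using a by (simp add: character_eq sum_distrib_left sum_distrib_right mult_ac)
    finally show ?thesis .
  qed
  have "(\<Sum>x\<in>carrier G. f (x \<otimes> a \<otimes> (inv x \<otimes> b))) =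
      (\<Sum>x\<in>carrier G. \<Sum>p<n. \<Sum>q<n. A p q * R (x \<otimes> a \<otimes> (inv x \<otimes> b)) $$ (p, q))"
    using a b by (intro sum.cong refl A) auto
  also have "\<dots> = (\<Sum>p<n. \<Sum>q<n. A p q * (\<Sum>x\<in>carrier G. R (x \<otimes> a \<otimes> (inv x \<otimes> b)) $$ (p, q)))"
    unfolding sum_distrib_left by (subst sum.swap, rule sum.cong, simp, rule sum.swap)
  also have "\<dots> = c * chi a * f b" using a b by (simp add: entry A sum_distrib_left mult_ac)
  finally show ?thesis .
qed

text \<open>Of the terms in the expansion of \<open>F\<close>, the product term turns into
  \<open>c\<close> times the merged term and the merged term into \<open>c\<close> times the product
  term. This exchange produces the sign, and by induction the remaining terms carry the same factor
  \<open>- c\<close>.\<close>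

lemma frob_char_convolution:
  assumes "a \<in> carrier G" and "b \<in> carrier G" and "set ts \<subseteq> carrier G"
  shows "(\<Sum>x\<in>carrier G. F ((x \<otimes> a) # (inv x \<otimes> b) # ts)) = - c * F (a # b # ts)"
  using assms
proof (induction "length ts" arbitrary: a b ts rule: less_induct)
  case less
  note a = less.prems(1) and b = less.prems(2) and ts = less.prems(3)
  have expand: "F (u # v # ts) = chi u * F (v # ts) - F ((u \<otimes> v) # ts)
      - (\<Sum>y\<in>#mset ts. F ((u \<otimes> y) # v # remove1 y ts))"
    if u: "u \<in> carrier G" and v: "v \<in> carrier G" for u v
  proof -
    have "(\<Sum>y\<in>#mset ts. F ((u \<otimes> y) # remove1 y (v # ts))) =
        (\<Sum>y\<in>#mset ts. F ((u \<otimes> y) # v # remove1 y ts))"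
    proof (rule arg_cong[of _ _ sum_mset], rule image_mset_cong, rule F_mset_cong)
      fix y assume "y \<in># mset ts"
      then have y: "y \<in> set ts" by simp
      show "set ((u \<otimes> y) # remove1 y (v # ts)) \<subseteq> carrier G"
        using y u v ts set_remove1_subset[of y ts] by auto
      show "mset ((u \<otimes> y) # remove1 y (v # ts)) = mset ((u \<otimes> y) # v # remove1 y ts)"
        using y by auto
    qed
    moreover have "F (u # v # ts) =
        chi u * F (v # ts) - (\<Sum>y\<in>#mset (v # ts). F ((u \<otimes> y) # remove1 y (v # ts)))"
      by (rule F_Cons_mset) (use u v ts in auto)
    ultimately show ?thesis
      by (simp only: mset.simps image_mset_add_mset sum_mset.add_mset remove1.simps(2)
          simp_thms if_True diff_diff_eq)
  qed
  \<comment> \<open>The entry \<open>y\<close> has been absorbed into the first argument, so the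
    induction hypothesis is used with \<open>a \<otimes> y\<close> and the shorter list.\<close>
  have IH: "(\<Sum>x\<in>carrier G. F ((x \<otimes> a \<otimes> y) # (inv x \<otimes> b) # remove1 y ts)) =
      - c * F ((a \<otimes> y) # b # remove1 y ts)" if "y \<in># mset ts" for y
  proof -
    have y: "y \<in> set ts" "y \<in> carrier G" using that ts by auto
    have "(\<Sum>x\<in>carrier G. F ((x \<otimes> a \<otimes> y) # (inv x \<otimes> b) # remove1 y ts)) =
        (\<Sum>x\<in>carrier G. F ((x \<otimes> (a \<otimes> y)) # (inv x \<otimes> b) # remove1 y ts))"
      using a y by (intro sum.cong) (auto simp: m_assoc)
    also have "\<dots> = - c * F ((a \<otimes> y) # b # remove1 y ts)"
    proof (rule less.hyps)
      show "length (remove1 y ts) < length ts"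
        using y(1) length_pos_if_in_set[OF y(1)] by (simp add: length_remove1)
      show "set (remove1 y ts) \<subseteq> carrier G" using ts set_remove1_subset[of y ts] by blast
    qed (use a b y in auto)
    finally show ?thesis .
  qed
  have tail: "(\<Sum>x\<in>carrier G. \<Sum>y\<in>#mset ts. F ((x \<otimes> a \<otimes> y) # (inv x \<otimes> b) # remove1 y ts)) =
      - c * (\<Sum>y\<in>#mset ts. F ((a \<otimes> y) # b # remove1 y ts))"
  proof -
    have "(\<Sum>x\<in>carrier G. \<Sum>y\<in>#mset ts. F ((x \<otimes> a \<otimes> y) # (inv x \<otimes> b) # remove1 y ts)) =
      (\<Sum>y\<in>#mset ts. \<Sum>x\<in>carrier G. F ((x \<otimes> a \<otimes> y) # (inv x \<otimes> b) # remove1 y ts))"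
      unfolding sum_unfold_sum_mset by (rule sum_mset.swap)
    also have "\<dots> = (\<Sum>y\<in>#mset ts. - c * F ((a \<otimes> y) # b # remove1 y ts))"
      by (rule arg_cong[of _ _ sum_mset], rule image_mset_cong, rule IH)
    also have "\<dots> = - c * (\<Sum>y\<in>#mset ts. F ((a \<otimes> y) # b # remove1 y ts))"
      by (rule sum_mset_distrib_left[symmetric])
    finally show ?thesis .
  qed
  have "(\<Sum>x\<in>carrier G. F ((x \<otimes> a) # (inv x \<otimes> b) # ts)) =
      (\<Sum>x\<in>carrier G. chi (x \<otimes> a) * F ((inv x \<otimes> b) # ts)) -
      (\<Sum>x\<in>carrier G. F ((x \<otimes> a \<otimes> (inv x \<otimes> b)) # ts)) -
      (\<Sum>x\<in>carrier G. \<Sum>y\<in>#mset ts. F ((x \<otimes> a \<otimes> y) # (inv x \<otimes> b) # remove1 y ts))"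
    unfolding sum_subtractf[symmetric] by (intro sum.cong refl expand) (use a b in auto)
  also have "\<dots> = c * F ((a \<otimes> b) # ts) - c * chi a * F (b # ts)
      + c * (\<Sum>y\<in>#mset ts. F ((a \<otimes> y) # b # remove1 y ts))"
    unfolding tail character_convolution[OF coefficient_function_F[OF ts] a b]
      conjugation_average[OF coefficient_function_F[OF ts] a b]
    by (simp only: diff_minus_eq_add mult_minus_left)
  also have "\<dots> = - c * F (a # b # ts)"
  proof -
    have "c * A - c * X * B + c * Z = - c * (X * B - A - Z)" for A X B Z
      by (simp add: algebra_simps)
    then show ?thesis unfolding expand[OF a b] by this
  qed
  finally show ?case .
qed

lemma frob_char_one_Cons:
  assumes "set ts \<subseteq> carrier G"
  shows "F (\<one> # ts) = (of_nat n - of_nat (length ts)) * F ts"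
proof -
  have "(\<Sum>j<length ts. F (ts[j := \<one> \<otimes> ts ! j])) = (\<Sum>j<length ts. F ts)"
    using assms by (intro sum.cong refl) (simp add: subset_code(1))
  then show ?thesis by (simp add: frob_char_Cons character_at_one left_diff_distrib)
qed

end

section \<open>Orthogonality of Frobenius characters\<close>

lemma finite_group_tuples [simp]: "finite (carrier G) \<Longrightarrow> finite (group_tuples G m)"
  using finite_lists_length_eq[of "carrier G" m] by (simp add: group_tuples_def conj_commute)

lemma group_tuples_0: "group_tuples G 0 = {[]}"
  by (auto simp: group_tuples_def)

lemma sum_group_tuples_Suc:
  "(\<Sum>gs\<in>group_tuples G (Suc m). f gs) = (\<Sum>g\<in>carrier G. \<Sum>ts\<in>group_tuples G m. f (g # ts))"
  unfolding sum.cartesian_product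
  by (rule sum.reindex_bij_witness[of _ "\<lambda>(g, ts). g # ts" "\<lambda>gs. (hd gs, tl gs)"])
    (auto simp: group_tuples_def length_Suc_conv)

text \<open>Multiplying entry \<open>j\<close> by \<open>g\<close> permutes the tuples. The two
  arguments of \<open>f\<close> let the translation pass from one factor of a product to the
  other.\<close>

lemma (in group) sum_group_tuples_update:
  assumes j: "j < m" and g: "g \<in> carrier G"
  shows "(\<Sum>ts\<in>group_tuples G m. f (ts[j := g \<otimes> ts ! j]) ts) =
    (\<Sum>ts\<in>group_tuples G m. f ts (ts[j := inv g \<otimes> ts ! j]))"
proof -
  have upd: "ts[j := h \<otimes> ts ! j] \<in> group_tuples G m"
    if "ts \<in> group_tuples G m" "h \<in> carrier G" for ts h
    unfolding group_tuples_def mem_Collect_eq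
  proof
    have ts: "length ts = m" "set ts \<subseteq> carrier G" using that by (auto simp: group_tuples_def)
    then have "insert (h \<otimes> ts ! j) (set ts) \<subseteq> carrier G" using that j by (auto simp: subset_code(1))
    then show "set (ts[j := h \<otimes> ts ! j]) \<subseteq> carrier G"
      using set_update_subset_insert[of ts j "h \<otimes> ts ! j"] by blast
    show "length (ts[j := h \<otimes> ts ! j]) = m" using ts by simp
  qed
  have len: "length ts = m" if "ts \<in> group_tuples G m" for ts
    using that by (simp add: group_tuples_def)
  have cancel: "ts[j := h \<otimes> (k \<otimes> ts ! j)] = ts"
    if "ts \<in> group_tuples G m" "h \<in> carrier G" "k \<in> carrier G" "h \<otimes> k = \<one>" for ts h k
  proof -
    have "ts ! j \<in> carrier G" using that(1) j by (auto simp: group_tuples_def)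
    then have "h \<otimes> (k \<otimes> ts ! j) = ts ! j" using that by (simp add: m_assoc[symmetric])
    then show ?thesis by simp
  qed
  show ?thesis
    by (rule sum.reindex_bij_witness[of _ "\<lambda>ts. ts[j := inv g \<otimes> ts ! j]" "\<lambda>ts. ts[j := g \<otimes> ts ! j]"])
      (use g j len in \<open>auto simp: upd cancel\<close>)
qed

context irreducible_representation
begin

text \<open>With \<open>cnj (chi g)\<close> read as \<open>chi (inv g)\<close>, this is a
  convolution evaluated at the unit.\<close>

lemma sum_cnj_character_frob_char:
  assumes "set ts \<subseteq> carrier G"
  shows "(\<Sum>g\<in>carrier G. cnj (chi g) * F (g # ts)) = c * (of_nat n - of_nat (length ts)) * F ts"
proof -
  have "(\<Sum>g\<in>carrier G. cnj (chi g) * F (g # ts)) = (\<Sum>g\<in>carrier G. chi (inv g) * F (inv (inv g) # ts))"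
    by (intro sum.cong) (auto simp: character_inv[OF irr])
  also have "\<dots> = (\<Sum>g\<in>carrier G. chi (g \<otimes> \<one>) * F ((inv g \<otimes> \<one>) # ts))"
    by (subst sum_inverse[where f = "\<lambda>g. chi g * F (inv g # ts)"]) simp
  also have "\<dots> = c * F ((\<one> \<otimes> \<one>) # ts)"
    by (rule character_convolution[OF coefficient_function_F[OF assms]]) auto
  finally show ?thesis by (simp add: frob_char_one_Cons[OF assms])
qed

text \<open>Symmetry moves the updated entry next to \<open>g\<close>. Then
  \<open>frob_char_convolution\<close> with first argument 1 applies, and
  \<open>frob_char_one_Cons\<close> removes the unit.\<close>

lemma sum_frob_char_update:
  assumes ts: "set ts \<subseteq> carrier G" and j: "j < length ts"
  shows "(\<Sum>g\<in>carrier G. F (g # ts[j := inv g \<otimes> ts ! j])) =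
    - c * (of_nat n - of_nat (length ts)) * F ts"
proof -
  have tj: "ts ! j \<in> set ts" "ts ! j \<in> carrier G" using ts j by auto
  note rem = set_remove1_subset[of "ts ! j" ts]
  have "(\<Sum>g\<in>carrier G. F (g # ts[j := inv g \<otimes> ts ! j])) =
      (\<Sum>g\<in>carrier G. F ((g \<otimes> \<one>) # (inv g \<otimes> ts ! j) # remove1 (ts ! j) ts))"
  proof (rule sum.cong[OF refl], rule F_mset_cong)
    fix g assume g: "g \<in> carrier G"
    show "set (g # ts[j := inv g \<otimes> ts ! j]) \<subseteq> carrier G"
      using g tj ts set_update_subset_insert[of ts j "inv g \<otimes> ts ! j"] by auto
    show "mset (g # ts[j := inv g \<otimes> ts ! j]) =
        mset ((g \<otimes> \<one>) # (inv g \<otimes> ts ! j) # remove1 (ts ! j) ts)"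
      using g j by (simp add: mset_update)
  qed
  also have "\<dots> = - c * F (\<one> # ts ! j # remove1 (ts ! j) ts)"
    using tj ts rem by (intro frob_char_convolution) auto
  also have "F (\<one> # ts ! j # remove1 (ts ! j) ts) = F (\<one> # ts)"
    by (rule F_mset_cong) (use tj ts rem in auto)
  finally show ?thesis by (simp add: frob_char_one_Cons[OF ts])
qed

text \<open>Only the conjugated factor is expanded. The product term and each of the
  \<open>m\<close> absorption terms contribute the same amount, whence the factor
  \<open>Suc m\<close>.\<close>

lemma frob_char_norm_Suc:
  "(\<Sum>gs\<in>group_tuples G (Suc m). cnj (F gs) * F gs) =
    of_nat (Suc m) * c * (of_nat n - of_nat m) * (\<Sum>ts\<in>group_tuples G m. cnj (F ts) * F ts)"
    (is "_ = _ * ?N")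
proof -
  let ?T = "group_tuples G m"
  have T: "length ts = m" "set ts \<subseteq> carrier G" if "ts \<in> ?T" for ts
    using that by (auto simp: group_tuples_def)
  have "(\<Sum>gs\<in>group_tuples G (Suc m). cnj (F gs) * F gs) =
      (\<Sum>g\<in>carrier G. \<Sum>ts\<in>?T. cnj (F ts) * (cnj (chi g) * F (g # ts))
        - (\<Sum>j<m. cnj (F (ts[j := g \<otimes> ts ! j])) * F (g # ts)))"
    unfolding sum_group_tuples_Suc
  proof (intro sum.cong refl)
    fix g ts assume "ts \<in> ?T"
    then have "cnj (F (g # ts)) = cnj (chi g) * cnj (F ts) - (\<Sum>j<m. cnj (F (ts[j := g \<otimes> ts ! j])))"
      by (simp add: frob_char_Cons[of G chi g ts] T)
    then show "cnj (F (g # ts)) * F (g # ts) = cnj (F ts) * (cnj (chi g) * F (g # ts))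
        - (\<Sum>j<m. cnj (F (ts[j := g \<otimes> ts ! j])) * F (g # ts))"
      unfolding \<open>cnj (F (g # ts)) = _\<close> by (simp add: sum_distrib_left algebra_simps)
  qed
  also have "\<dots> = (\<Sum>ts\<in>?T. cnj (F ts) * (\<Sum>g\<in>carrier G. cnj (chi g) * F (g # ts)))
      - (\<Sum>j<m. \<Sum>g\<in>carrier G. \<Sum>ts\<in>?T. cnj (F (ts[j := g \<otimes> ts ! j])) * F (g # ts))"
  proof -
    have "(\<Sum>g\<in>carrier G. \<Sum>ts\<in>?T. cnj (F ts) * (cnj (chi g) * F (g # ts))) =
        (\<Sum>ts\<in>?T. cnj (F ts) * (\<Sum>g\<in>carrier G. cnj (chi g) * F (g # ts)))"
      unfolding sum_distrib_left by (rule sum.swap)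
    moreover have "(\<Sum>g\<in>carrier G. \<Sum>ts\<in>?T. \<Sum>j<m. cnj (F (ts[j := g \<otimes> ts ! j])) * F (g # ts)) =
        (\<Sum>j<m. \<Sum>g\<in>carrier G. \<Sum>ts\<in>?T. cnj (F (ts[j := g \<otimes> ts ! j])) * F (g # ts))"
      by (rule sym, subst sum.swap, rule sum.cong, simp, rule sum.swap)
    ultimately show ?thesis by (simp add: sum_subtractf)
  qed
  also have "(\<Sum>ts\<in>?T. cnj (F ts) * (\<Sum>g\<in>carrier G. cnj (chi g) * F (g # ts))) =
      c * (of_nat n - of_nat m) * ?N"
    unfolding sum_distrib_left
    by (intro sum.cong refl) (simp add: sum_cnj_character_frob_char T sum_distrib_left[symmetric])
  \<comment> \<open>The translation by \<open>g\<close> is shifted to the other factor as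
    \<open>inv g\<close>, where \<open>sum_frob_char_update\<close> evaluates the sum over
    \<open>g\<close>; its minus sign cancels that of the recursion.\<close>
  also have "(\<Sum>j<m. \<Sum>g\<in>carrier G. \<Sum>ts\<in>?T. cnj (F (ts[j := g \<otimes> ts ! j])) * F (g # ts)) =
      (\<Sum>j<m. - c * (of_nat n - of_nat m) * ?N)"
  proof (rule sum.cong[OF refl])
    fix j assume "j \<in> {..<m}"
    then have j: "j < m" by simp
    have "(\<Sum>g\<in>carrier G. \<Sum>ts\<in>?T. cnj (F (ts[j := g \<otimes> ts ! j])) * F (g # ts)) =
        (\<Sum>g\<in>carrier G. \<Sum>ts\<in>?T. cnj (F ts) * F (g # ts[j := inv g \<otimes> ts ! j]))"
      by (intro sum.cong refl sum_group_tuples_update[OF j,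
            where f = "\<lambda>us vs. cnj (F us) * F (_ # vs)"])
    also have "\<dots> = (\<Sum>ts\<in>?T. cnj (F ts) * (\<Sum>g\<in>carrier G. F (g # ts[j := inv g \<otimes> ts ! j])))"
      unfolding sum_distrib_left by (rule sum.swap)
    also have "\<dots> = - c * (of_nat n - of_nat m) * ?N"
      unfolding sum_distrib_left
      by (intro sum.cong refl) (simp add: sum_frob_char_update T j sum_distrib_left[symmetric])
    finally show "(\<Sum>g\<in>carrier G. \<Sum>ts\<in>?T. cnj (F (ts[j := g \<otimes> ts ! j])) * F (g # ts)) =
        - c * (of_nat n - of_nat m) * ?N" .
  qed
  finally show ?thesis by (simp add: algebra_simps)
qed

text \<open>For \<open>m > n\<close> the product contains the factor with \<open>k = n\<close>, so
  the norm is nonzero exactly for \<open>m\<close> up to the dimension.\<close>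

lemma frob_char_norm:
  "(\<Sum>gs\<in>group_tuples G m. cnj (F gs) * F gs) = fact m * c ^ m * (\<Prod>k<m. of_nat n - of_nat k)"
  by (induction m) (simp_all only: group_tuples_0 frob_char_norm_Suc, simp_all add: mult_ac)

text \<open>\<open>R\<close> need not be unitary, so \<open>cnj (f x)\<close> is not visibly a
  matrix coefficient at \<open>inv x\<close>. Writing \<open>f\<close> as a convolution with
  \<open>chi\<close> moves the conjugation to where \<open>character_inv\<close> handles it, and the
  convolution of \<open>chi\<close> with \<open>f'\<close> vanishes.\<close>

lemma coefficient_functions_orthogonal:
  assumes irr': "irreducible_rep G n' R'" and neq: "\<not> equivalent_reps G R R'"
    and f: "coefficient_function f"
    and f': "irreducible_representation.coefficient_function G n' R' f'"
  shows "(\<Sum>x\<in>carrier G. cnj (f x) * f' x) = 0"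
proof -
  interpret R': irreducible_representation G n' R' by unfold_locales (rule irr')
  obtain A where A: "\<And>g. g \<in> carrier G \<Longrightarrow> f' g = (\<Sum>p<n'. \<Sum>q<n'. A p q * R' g $$ (p, q))"
    using f' by (auto simp: R'.coefficient_function_def)
  have entry: "(\<Sum>x\<in>carrier G. chi x * R' (inv x \<otimes> y) $$ (p, q)) = 0"
    if pq: "p < n'" "q < n'" and y: "y \<in> carrier G" for p q y
  proof -
    have "(\<Sum>x\<in>carrier G. chi x * R' (inv x \<otimes> y) $$ (p, q)) =
        (\<Sum>x\<in>carrier G. \<Sum>k<n. \<Sum>t<n'. R' y $$ (t, q) * (R x $$ (k, k) * R' (inv x) $$ (p, t)))"
      using pq y by (simp add: character_eq rep_mult_index[OF irr'] sum_product mult_ac)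
    also have "\<dots> = (\<Sum>k<n. \<Sum>t<n'. R' y $$ (t, q) * (\<Sum>x\<in>carrier G. R x $$ (k, k) * R' (inv x) $$ (p, t)))"
      unfolding sum_distrib_left by (subst sum.swap, rule sum.cong, simp, rule sum.swap)
    also have "\<dots> = 0" using pq by (simp add: matrix_coefficients_orthogonal[OF irr irr' neq])
    finally show ?thesis .
  qed
  have conv: "(\<Sum>x\<in>carrier G. chi x * f' (inv x \<otimes> y)) = 0" if y: "y \<in> carrier G" for y
  proof -
    have "(\<Sum>x\<in>carrier G. chi x * f' (inv x \<otimes> y)) =
        (\<Sum>x\<in>carrier G. \<Sum>p<n'. \<Sum>q<n'. A p q * (chi x * R' (inv x \<otimes> y) $$ (p, q)))"
      using y by (simp add: A sum_distrib_left mult_ac)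
    also have "\<dots> = (\<Sum>p<n'. \<Sum>q<n'. A p q * (\<Sum>x\<in>carrier G. chi x * R' (inv x \<otimes> y) $$ (p, q)))"
      unfolding sum_distrib_left by (subst sum.swap, rule sum.cong, simp, rule sum.swap)
    also have "\<dots> = 0" using y by (simp add: entry)
    finally show ?thesis .
  qed
  have "cnj c * (\<Sum>x\<in>carrier G. cnj (f x) * f' x) =
      (\<Sum>x\<in>carrier G. \<Sum>g\<in>carrier G. cnj (chi g) * cnj (f (inv g \<otimes> x)) * f' x)"
    unfolding sum_distrib_left
  proof (rule sum.cong[OF refl])
    fix x assume x: "x \<in> carrier G"
    have "c * f x = (\<Sum>g\<in>carrier G. chi g * f (inv g \<otimes> x))"
      using character_convolution[OF f one_closed x] x by simp
    then have "cnj c * cnj (f x) = (\<Sum>g\<in>carrier G. cnj (chi g) * cnj (f (inv g \<otimes> x)))"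
      by (metis (no_types, lifting) complex_cnj_mult cnj_sum sum.cong)
    then show "cnj c * (cnj (f x) * f' x) =
        (\<Sum>g\<in>carrier G. cnj (chi g) * cnj (f (inv g \<otimes> x)) * f' x)"
      by (simp add: mult.assoc[symmetric] sum_distrib_right)
  qed
  also have "\<dots> = (\<Sum>g\<in>carrier G. \<Sum>x\<in>carrier G. cnj (chi g) * cnj (f (inv g \<otimes> x)) * f' x)"
    by (rule sum.swap)
  \<comment> \<open>Replacing \<open>x\<close> by \<open>g \<otimes> x\<close> frees
    \<open>f\<close> from \<open>g\<close>, so that the inner sum becomes the convolution of
    \<open>chi\<close> with \<open>f'\<close>.\<close>
  also have "\<dots> = (\<Sum>g\<in>carrier G. \<Sum>x\<in>carrier G. cnj (chi g) * cnj (f (inv g \<otimes> (g \<otimes> x))) * f' (g \<otimes> x))"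
    by (intro sum.cong refl sum_translate_left[symmetric])
  also have "\<dots> = (\<Sum>g\<in>carrier G. \<Sum>x\<in>carrier G. cnj (f x) * (chi (inv g) * f' (inv (inv g) \<otimes> x)))"
    by (intro sum.cong refl) (simp add: m_assoc[symmetric] character_inv[OF irr])
  also have "\<dots> = (\<Sum>x\<in>carrier G. cnj (f x) * (\<Sum>g\<in>carrier G. chi (inv g) * f' (inv (inv g) \<otimes> x)))"
    unfolding sum_distrib_left by (rule sum.swap)
  also have "\<dots> = (\<Sum>x\<in>carrier G. cnj (f x) * (\<Sum>g\<in>carrier G. chi g * f' (inv g \<otimes> x)))"
    by (intro sum.cong refl arg_cong2[of _ _ _ _ "(*)"] sum_inverse)
  also have "\<dots> = 0" by (simp add: conv)
  finally show ?thesis using c_nonzero by simp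
qed

text \<open>The sum over the first entry already vanishes for each choice of the others. For
  \<open>m = 0\<close> there is no such entry, and the sum would be 1.\<close>

lemma frob_chars_orthogonal:
  assumes irr': "irreducible_rep G n' R'" and neq: "\<not> equivalent_reps G R R'" and "m > 0"
  shows "(\<Sum>gs\<in>group_tuples G m. cnj (F gs) * frob_char G (character R') gs) = 0"
proof -
  interpret R': irreducible_representation G n' R' by unfold_locales (rule irr')
  obtain l where m: "m = Suc l" using \<open>m > 0\<close> gr0_conv_Suc by auto
  have "(\<Sum>g\<in>carrier G. cnj (F (g # ts)) * R'.F (g # ts)) = 0" if "ts \<in> group_tuples G l" for ts
    using that by (intro coefficient_functions_orthogonal[OF irr' neq] coefficient_function_F
        R'.coefficient_function_F) (auto simp: group_tuples_def)
  then show ?thesis unfolding m sum_group_tuples_Suc by (subst sum.swap) simp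
qed

end

section \<open>From orthogonality to the generating function\<close>

lemma has_sum_sum:
  fixes f :: "'i \<Rightarrow> 'a \<Rightarrow> 'b :: topological_comm_monoid_add"
  assumes "finite I" and "\<And>i. i \<in> I \<Longrightarrow> (f i has_sum s i) A"
  shows "((\<lambda>x. \<Sum>i\<in>I. f i x) has_sum (\<Sum>i\<in>I. s i)) A"
  using assms by (induction I) (auto intro: has_sum_add)

text \<open>The constant of the theorem is the inverse of the norm, with \<open>N\<close> the group
  order: the factor \<open>n\<close> at \<open>k = 0\<close> cancels one of the \<open>r\<close>
  powers of \<open>n\<close> in the denominator, leaving \<open>n ^ (r - 1)\<close>.\<close>

lemma frob_char_norm_constant:
  fixes n r :: nat and N :: complex
  assumes "1 \<le> r" and "r \<le> n" and "N \<noteq> 0"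
  shows "of_nat n ^ (r - 1) / (fact r * N ^ r * (\<Prod>k=1..r-1. (of_nat n - of_nat k))) *
    (fact r * (N / of_nat n) ^ r * (\<Prod>k<r. of_nat n - of_nat k)) = 1"
proof -
  define P :: complex where "P = (\<Prod>k=1..r-1. of_nat n - of_nat k)"
  have "of_nat n \<noteq> (of_nat k :: complex)" if "k \<in> {1..r-1}" for k
    using that assms by auto
  then have P: "P \<noteq> 0" by (auto simp: P_def)
  have "{..<r} = insert 0 {1..r-1}" using assms by auto
  then have prod: "(\<Prod>k<r. of_nat n - of_nat k) = of_nat n * P" by (simp add: P_def)
  have n: "of_nat n \<noteq> (0 :: complex)" using assms by auto
  have pow: "(of_nat n :: complex) ^ r = of_nat n * of_nat n ^ (r - 1)"
    using assms by (cases r) auto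
  show ?thesis
    unfolding prod P_def[symmetric] power_divide pow using P n \<open>N \<noteq> 0\<close> by simp
qed

text \<open>Pairing \<open>frob_coeff\<close> with the \<open>r\<close>-character of
  \<open>\<rho> i\<close> annihilates all summands but the \<open>i\<close>-th, and the constant
  divides out its norm.\<close>

lemma mult_coeff_eq:
  assumes G: "group G" "finite (carrier G)" and irreps: "complete_irreps G t \<rho>"
    and i: "i \<in> {1..t}" and r: "1 \<le> r" "r \<le> rep_dim G (\<rho> i)"
  shows "mult_coeff G smul act V t \<rho> i \<nu> =
    of_nat (rep_dim G (\<rho> i)) ^ (r - 1) /
      (fact r * of_nat (order G) ^ r * (\<Prod>k=1..r-1. (of_nat (rep_dim G (\<rho> i)) - of_nat k))) *
    (\<Sum>gs\<in>group_tuples G r.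
       cnj (frob_char G (character (\<rho> i)) gs) * frob_coeff G smul act V t \<rho> gs \<nu>)"
    (is "?m i = ?K * (\<Sum>gs\<in>?T. cnj (?F i gs) * _)")
proof -
  have irred: "irreducible_rep G (rep_dim G (\<rho> j)) (\<rho> j)" if "j \<in> {1..t}" for j
    using irreps[unfolded complete_irreps_def, THEN conjunct1] that by (rule bspec)
  have neq: "\<not> equivalent_reps G (\<rho> i) (\<rho> j)" if "j \<in> {1..t}" "j \<noteq> i" for j
    using irreps[unfolded complete_irreps_def, THEN conjunct2, THEN conjunct1] i that by metis
  interpret finite_group G
    using G by (simp add: finite_group_def finite_group_axioms_def)
  interpret irreducible_representation G "rep_dim G (\<rho> i)" "\<rho> i"
    by unfold_locales (rule irred[OF i])
  have orth: "(\<Sum>gs\<in>?T. cnj (?F i gs) * ?F j gs) = 0" if "j \<in> {1..t}" "j \<noteq> i" for j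
    by (rule frob_chars_orthogonal[OF irred neq]) (use that r in simp_all)
  have "(\<Sum>gs\<in>?T. cnj (?F i gs) * frob_coeff G smul act V t \<rho> gs \<nu>) =
      (\<Sum>gs\<in>?T. \<Sum>j=1..t. ?m j * (cnj (?F i gs) * ?F j gs))"
    unfolding frob_coeff_def mult_coeff_def sum_distrib_left
    by (intro sum.cong refl mult.left_commute)
  also have "\<dots> = (\<Sum>j=1..t. ?m j * (\<Sum>gs\<in>?T. cnj (?F i gs) * ?F j gs))"
    unfolding sum_distrib_left by (rule sum.swap)
  also have "\<dots> = ?m i * (\<Sum>gs\<in>?T. cnj (?F i gs) * ?F i gs)"
  proof -
    have "(\<Sum>j\<in>{1..t} - {i}. ?m j * (\<Sum>gs\<in>?T. cnj (?F i gs) * ?F j gs)) = 0"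
      by (intro sum.neutral ballI) (simp add: orth)
    then show ?thesis using i by (subst sum.remove[of _ i]) simp_all
  qed
  finally have "?K * (\<Sum>gs\<in>?T. cnj (?F i gs) * frob_coeff G smul act V t \<rho> gs \<nu>) =
      ?m i * (?K * (\<Sum>gs\<in>?T. cnj (?F i gs) * ?F i gs))"
    by (simp only: mult.left_commute)
  also have "?K * (\<Sum>gs\<in>?T. cnj (?F i gs) * ?F i gs) = 1"
    unfolding frob_char_norm c_def
    by (rule frob_char_norm_constant) (use r order_gt_0_iff_finite in auto)
  finally show ?thesis by simp
qed

theorem theorem1p2:
  fixes G :: "('g, 'm) monoid_scheme"
    and smul :: "complex \<Rightarrow> 'v::ab_group_add \<Rightarrow> 'v"
    and act :: "'g \<Rightarrow> 'v \<Rightarrow> 'v"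
    and V :: "int \<Rightarrow> 'v set"
    and d :: int
    and \<rho> :: "nat \<Rightarrow> 'g \<Rightarrow> complex mat"
    and s r t i :: nat
  assumes "group G" and "finite (carrier G)"
    and "complete_irreps G t \<rho>"
    and "graded_G_module G smul act V d"
    and "s \<ge> 1"
    and "weak_moonshine s G smul act V d t \<rho>"
    and "1 \<le> r" and "r \<le> s"
    and "i \<in> {1..t}"
    and "rep_dim G (\<rho> i) \<ge> r"
  shows "q_series_converges d (mult_coeff G smul act V t \<rho> i) \<and>
    (\<forall>\<tau>\<in>upper_half_plane.
       mult_gen_fun G smul act V d t \<rho> i \<tau> =
         of_nat (rep_dim G (\<rho> i)) ^ (r - 1) /
         (fact r * of_nat (order G) ^ r * (\<Prod>k=1..r-1. (of_nat (rep_dim G (\<rho> i)) - of_nat k))) *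
         (\<Sum>gs\<in>group_tuples G r.
            cnj (frob_char G (character (\<rho> i)) gs) * mckay_thompson G smul act V d t \<rho> gs \<tau>))"
proof (intro conjI ballI)
  let ?T = "group_tuples G r"
  let ?F = "frob_char G (character (\<rho> i))"
  let ?K = "of_nat (rep_dim G (\<rho> i)) ^ (r - 1) /
    (fact r * of_nat (order G) ^ r * (\<Prod>k=1..r-1. (of_nat (rep_dim G (\<rho> i)) - of_nat k))) :: complex"
  let ?a = "frob_coeff G smul act V t \<rho>"
  have coeff: "mult_coeff G smul act V t \<rho> i \<nu> * nome \<tau> powi \<nu> =
      ?K * (\<Sum>gs\<in>?T. cnj (?F gs) * (?a gs \<nu> * nome \<tau> powi \<nu>))" for \<nu> \<tau>
    unfolding mult_coeff_eq[OF assms(1-3,9,7,10)] by (simp only: sum_distrib_right mult.assoc)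
  \<comment> \<open>A finite combination of the convergent series of width \<open>r\<close> gives
    both claims at once, the convergence and the value.\<close>
  have has_sum: "((\<lambda>\<nu>. mult_coeff G smul act V t \<rho> i \<nu> * nome \<tau> powi \<nu>) has_sum
      ?K * (\<Sum>gs\<in>?T. cnj (?F gs) * mckay_thompson G smul act V d t \<rho> gs \<tau>)) (grading_degrees d)"
    if "\<tau> \<in> upper_half_plane" for \<tau>
    unfolding coeff mckay_thompson_def q_series_def
  proof (intro has_sum_cmult_right has_sum_sum has_sum_infsum)
    show "(\<lambda>\<nu>. ?a gs \<nu> * nome \<tau> powi \<nu>) summable_on grading_degrees d" if "gs \<in> ?T" for gs
      using assms(6-8) that \<open>\<tau> \<in> upper_half_plane\<close>
      by (auto simp: weak_moonshine_def q_series_converges_def)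
  qed (use assms(2) in simp)
  show "q_series_converges d (mult_coeff G smul act V t \<rho> i)"
    unfolding q_series_converges_def by (blast intro: has_sum_imp_summable has_sum)
  show "mult_gen_fun G smul act V d t \<rho> i \<tau> =
      ?K * (\<Sum>gs\<in>?T. cnj (?F gs) * mckay_thompson G smul act V d t \<rho> gs \<tau>)"
    if "\<tau> \<in> upper_half_plane" for \<tau>
    unfolding mult_gen_fun_def q_series_def by (rule infsumI[OF has_sum[OF that]])
qed

end
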